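(* Let $f\in C^1(\mathbb R)$ and let $-\infty<a_-<a_0<a_+<+\infty$ be such that $f(a_\pm)=f(a_0)=0$, $f'(a_\pm)>0$, $f>0$ in $(a_-,a_0)$ and $f<0$ in $(a_0,a_+)$. Let $A$ be the set of all $\alpha\in(a_-,a_0)$ with $\int_\alpha^{a_+}f(z)\,dz<0$. Then for each $\alpha\in A$: (i) the velocity $c_\alpha$ of a degenerate traveling wave with parameter $\alpha$ is uniquely determined; (ii) the profile function $\phi_\alpha$ of a degenerate traveling wave with parameter $\alpha$ is uniquely determined up to translation. Moreover, $c_\alpha$ is strictly decreasing in $\alpha\in A$; and, with $\phi_\alpha$ normalized by translation so that $\phi_\alpha\equiv\alpha$ on $(-\infty,0]$ and $\phi_\alpha>\alpha$ on $(0,+\infty)$, the map $\alpha\mapsto(c_\alpha,\phi_\alpha)$ is continuous from $A$ to $\mathbb R\times C(\mathbb R)$, i.e. if $\alpha_n\to\alpha$ with $\alpha_n,\alpha\in A$, then $c_{\alpha_n}\to c_\alpha$ and $\phi_{\alpha_n}\to\phi_\alpha$ uniformly on $\mathbb R$.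
   Context: A degenerate traveling wave with parameter $\alpha$ (for $\partial_tu=(\partial_x^2u-f(u))_+$, with $(s)_+=\max\{s,0\}$) is a pair $(c,\phi)$ with $c\in\mathbb R$ and $\phi\in W^{2,\infty}(\mathbb R)$ such that $$-c\phi'-\phi''+\partial I_{[\alpha,+\infty)}(\phi)+f(\phi)\ni0\ \text{ a.e. in }\mathbb R,$$ $$\lim_{\xi\to-\infty}\phi(\xi)=\alpha,\quad\lim_{\xi\to+\infty}\phi(\xi)=a_+,\quad\phi'\ge0\text{ in }\mathbb R,\quad\lim_{\xi\to\pm\infty}\phi'(\xi)=0,$$ and there is $s_*\in\mathbb R$ with $\phi=\alpha$ on $(-\infty,s_*]$ and $\phi>\alpha$ on $(s_*,+\infty)$. Here $\partial I_{[\alpha,+\infty)}(s)=\{0\}$ if $s>\alpha$, $=(-\infty,0]$ if $s=\alpha$, $=\emptyset$ if $s<\alpha$. For every $\alpha\in A$ at least one such pair exists, and then $u(x,t)=\phi(x-ct)$ solves $\partial_tu=(\partial_x^2u-f(u))_+$. *)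

theory Defs
  imports "HOL-Analysis.Analysis"
begin

definition test_function :: "(real \<Rightarrow> real) \<Rightarrow> bool" where
  "test_function \<psi> \<longleftrightarrow>
     (\<forall>k. (deriv ^^ k) \<psi> differentiable_on UNIV) \<and> compact (closure {x. \<psi> x \<noteq> 0})"

definition locally_integrable :: "(real \<Rightarrow> real) \<Rightarrow> bool" where
  "locally_integrable u \<longleftrightarrow> (\<forall>K. compact K \<longrightarrow> set_integrable lborel K u)"

definition has_weak_deriv :: "nat \<Rightarrow> (real \<Rightarrow> real) \<Rightarrow> (real \<Rightarrow> real) \<Rightarrow> bool" where
  "has_weak_deriv k u v \<longleftrightarrow>
     locally_integrable u \<and> locally_integrable v \<and>
     (\<forall>\<psi>. test_function \<psi> \<longrightarrow>
        (LINT x|lborel. u x * (deriv ^^ k) \<psi> x) = (- 1) ^ k * (LINT x|lborel. v x * \<psi> x))"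

(* Equivalence classes modulo null sets are handled through their Borel representatives. *)
definition L_infty :: "(real \<Rightarrow> real) set" where
  "L_infty = {u. u \<in> borel_measurable lborel \<and> (\<exists>C. AE x in lborel. \<bar>u x\<bar> \<le> C)}"

definition W_infty :: "nat \<Rightarrow> (real \<Rightarrow> real) set" where
  "W_infty k = {u. u \<in> L_infty \<and> (\<forall>j\<le>k. \<exists>v\<in>L_infty. has_weak_deriv j u v)}"

definition subdiff_indicator :: "real \<Rightarrow> real \<Rightarrow> real set" where
  "subdiff_indicator \<alpha> s = (if s > \<alpha> then {0} else if s = \<alpha> then {..0} else {})"

(* An element of W_infty 2 has a unique continuous representative, which is of class C^1;
   as usual, a profile is identified with this representative, so that pointwise conditions
   on it and on its (classical) derivative make sense.  The second derivative is the weak one;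
   it is determined up to a null set. *)
definition degenerate_wave ::
  "(real \<Rightarrow> real) \<Rightarrow> real \<Rightarrow> real \<Rightarrow> real \<Rightarrow> (real \<Rightarrow> real) \<Rightarrow> bool" where
  "degenerate_wave f a_plus \<alpha> c \<phi> \<longleftrightarrow>
     \<phi> \<in> W_infty 2 \<and> \<phi> C1_differentiable_on UNIV \<and>
     (\<exists>\<phi>2\<in>L_infty. has_weak_deriv 2 \<phi> \<phi>2 \<and>
        (AE \<xi> in lborel. \<exists>g\<in>subdiff_indicator \<alpha> (\<phi> \<xi>).
           - c * deriv \<phi> \<xi> - \<phi>2 \<xi> + g + f (\<phi> \<xi>) = 0)) \<and>
     (\<phi> \<longlongrightarrow> \<alpha>) at_bot \<and> (\<phi> \<longlongrightarrow> a_plus) at_top \<and>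
     (\<forall>\<xi>. deriv \<phi> \<xi> \<ge> 0) \<and>
     (deriv \<phi> \<longlongrightarrow> 0) at_bot \<and> (deriv \<phi> \<longlongrightarrow> 0) at_top \<and>
     (\<exists>s. (\<forall>\<xi>\<le>s. \<phi> \<xi> = \<alpha>) \<and> (\<forall>\<xi>>s. \<phi> \<xi> > \<alpha>))"

definition normalized_profile :: "real \<Rightarrow> (real \<Rightarrow> real) \<Rightarrow> bool" where
  "normalized_profile \<alpha> \<phi> \<longleftrightarrow> (\<forall>\<xi>\<le>0. \<phi> \<xi> = \<alpha>) \<and> (\<forall>\<xi>>0. \<phi> \<xi> > \<alpha>)"

definition wave_parameters :: "(real \<Rightarrow> real) \<Rightarrow> real \<Rightarrow> real \<Rightarrow> real \<Rightarrow> real set" where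
  "wave_parameters f a_minus a_zero a_plus =
     {\<alpha>. a_minus < \<alpha> \<and> \<alpha> < a_zero \<and> integral {\<alpha>..a_plus} f < 0}"

end

(* Along a wave the slope is a positive function p of the value z, with p' = f/p - c on (alpha, a_plus)
   and p = 0 at both ends. The difference q of two such orbits satisfies q' = -(f/(p1 p2)) q + (c2 - c1).
   Near a_plus, where f < 0, this forbids q > 0 when c1 <= c2, since q must vanish at a_plus; and where
   f > 0 the resulting q <= 0 makes q grow at rate at least c2 - c1. Starting from q = 0 at alpha this
   gives uniqueness of the speed, from q > 0 its monotonicity, and from q close to 0 its continuity.
   Once the speeds are under control, the profiles are compared by Gronwall's inequality for the
   initial value problem at the free boundary, where phi = alpha and phi' = 0; beyond a large
   interval both profiles are squeezed between their values there and a_plus. *)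

theory Submission
  imports Defs "HOL-Computational_Algebra.Polynomial"
begin

section \<open>Test functions\<close>

lemma exp_minus_inverse_le:
  fixes s :: real
  assumes "s > 0"
  shows "exp (- 1 / s) \<le> fact n * s ^ n"
proof -
  have "inverse (fact n) * (1 / s) ^ n = (\<Sum>k\<in>{n}. inverse (fact k) * (1 / s) ^ k)"
    by simp
  also have "\<dots> \<le> (\<Sum>k. inverse (fact k) * (1 / s) ^ k)"
    by (rule sum_le_suminf [OF summable_exp]) (use assms in auto)
  also have "\<dots> = exp (1 / s)"
    by (simp add: exp_def)
  finally show ?thesis
    using assms by (simp add: exp_minus field_simps)
qed

lemma DERIV_zero_if_quadratic_bound:
  fixes g :: "real \<Rightarrow> real"
  assumes "\<And>y. \<bar>g y\<bar> \<le> C * (y - x)\<^sup>2"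
  shows "(g has_real_derivative 0) (at x)"
proof -
  have g0: "g x = 0"
    using assms[of x] by simp
  have lim: "((\<lambda>y. C * \<bar>y - x\<bar>) \<longlongrightarrow> 0) (at x)"
    by (rule tendsto_eq_intros refl | simp)+
  have "((\<lambda>y. (g y - g x) / (y - x)) \<longlongrightarrow> 0) (at x)"
  proof (rule Lim_null_comparison [OF _ lim])
    show "\<forall>\<^sub>F y in at x. norm ((g y - g x) / (y - x)) \<le> C * \<bar>y - x\<bar>"
    proof (rule eventually_at_filter[THEN iffD2], rule always_eventually, intro allI impI)
      fix y assume "y \<noteq> x"
      then have "\<bar>g y\<bar> / \<bar>y - x\<bar> \<le> C * (y - x)\<^sup>2 / \<bar>y - x\<bar>"
        by (intro divide_right_mono assms) auto
      also have "\<dots> = C * \<bar>y - x\<bar>"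
        using \<open>y \<noteq> x\<close> by (simp add: power2_eq_square divide_simps)
      finally show "norm ((g y - g x) / (y - x)) \<le> C * \<bar>y - x\<bar>"
        by (simp add: g0)
    qed
  qed
  then show ?thesis
    by (simp add: has_field_derivative_iff)
qed

definition bump :: "real poly \<Rightarrow> nat \<Rightarrow> real \<Rightarrow> real" where
  "bump P k x =
     (if 0 < x \<and> x < 1 then poly P x / (x * (1 - x)) ^ k * exp (- 1 / (x * (1 - x))) else 0)"

lemma bump_bound:
  obtains C where "\<And>x. \<bar>bump P k x\<bar> \<le> C * x\<^sup>2" "\<And>x. \<bar>bump P k x\<bar> \<le> C * (x - 1)\<^sup>2"
proof -
  have "bounded (poly P ` {0..1})"
    by (intro compact_imp_bounded compact_continuous_image continuous_intros) auto
  then obtain M where M: "\<And>x. 0 \<le> x \<Longrightarrow> x \<le> 1 \<Longrightarrow> \<bar>poly P x\<bar> \<le> M"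
    unfolding bounded_iff by fastforce
  have M0: "M \<ge> 0"
    using M[of 0] by simp
  define C where "C = M * fact (k + 2)"
  have C0: "C \<ge> 0"
    by (simp add: C_def M0)
  have key: "\<bar>bump P k x\<bar> \<le> C * (x * (1 - x))\<^sup>2" if x: "0 < x" "x < 1" for x
  proof -
    define s where "s = x * (1 - x)"
    have s: "s > 0"
      using x by (simp add: s_def)
    have "\<bar>bump P k x\<bar> = \<bar>poly P x\<bar> / s ^ k * exp (- 1 / s)"
      using x s by (simp add: bump_def s_def abs_mult)
    also have "\<dots> \<le> M / s ^ k * (fact (k + 2) * s ^ (k + 2))"
      using x s M0 by (intro mult_mono divide_right_mono M exp_minus_inverse_le) auto
    also have "\<dots> = C * s\<^sup>2"
      using s unfolding C_def power_add by (simp del: fact_Suc add_2_eq_Suc')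
    finally show ?thesis
      by (simp add: s_def)
  qed
  have 1: "\<bar>bump P k x\<bar> \<le> C * x\<^sup>2" for x
  proof (cases "0 < x \<and> x < 1")
    case True
    have "(x * (1 - x))\<^sup>2 \<le> x\<^sup>2"
      using True by (intro power_mono mult_left_le) auto
    with key[of x] True C0 show ?thesis
      by (meson mult_left_mono order_trans)
  next
    case False
    then show ?thesis
      by (auto simp: bump_def C0)
  qed
  have 2: "\<bar>bump P k x\<bar> \<le> C * (x - 1)\<^sup>2" for x
  proof (cases "0 < x \<and> x < 1")
    case True
    have "(x * (1 - x))\<^sup>2 \<le> (1 - x)\<^sup>2"
      using True by (intro power_mono mult_left_le_one_le) auto
    with key[of x] True C0 show ?thesis
      by (metis mult_left_mono order_trans power2_commute)
  next
    case False
    then show ?thesis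
      by (auto simp: bump_def C0)
  qed
  from 1 2 show ?thesis
    by (rule that)
qed

lemma DERIV_bump:
  "\<exists>Q m. \<forall>x. (bump P k has_real_derivative bump Q m x) (at x)"
proof -
  define S :: "real poly" where "S = [:0, 1, -1:]"
  define Q where "Q = pderiv P * S\<^sup>2 - of_nat k * P * pderiv S * S + P * pderiv S"
  obtain C where C: "\<And>x. \<bar>bump P k x\<bar> \<le> C * x\<^sup>2" "\<And>x. \<bar>bump P k x\<bar> \<le> C * (x - 1)\<^sup>2"
    using bump_bound [of P k] by blast
  have S: "poly S x = x * (1 - x)" for x
    by (simp add: S_def algebra_simps)
  have "(bump P k has_real_derivative bump Q (k + 2) x) (at x)" for x
  proof -
    consider "0 < x" "x < 1" | "x = 0" | "x = 1" | "x < 0" | "x > 1"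
      by linarith
    then show ?thesis
    proof cases
      case 1
      have s: "poly S x > 0"
        using 1 by (simp add: S)
      define r where "r = inverse (poly S x)"
      have rS: "poly S x * r = 1"
        using s by (simp add: r_def)
      have "((\<lambda>x. poly P x * inverse (poly S x) ^ k * exp (- inverse (poly S x))) has_real_derivative
          (poly (pderiv P) x * r ^ k + poly P x * (of_nat k * r ^ (k - 1) * (- poly (pderiv S) x * (r * r))))
            * exp (- r)
          + poly P x * r ^ k * (exp (- r) * (poly (pderiv S) x * (r * r)))) (at x)"
        using s unfolding r_def
        by (auto intro!: derivative_eq_intros simp: divide_inverse)
      also have "(poly (pderiv P) x * r ^ k + poly P x * (of_nat k * r ^ (k - 1) * (- poly (pderiv S) x * (r * r))))
            * exp (- r)
          + poly P x * r ^ k * (exp (- r) * (poly (pderiv S) x * (r * r)))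
        = (poly (pderiv P) x * (poly S x * r)\<^sup>2 - of_nat k * poly P x * poly (pderiv S) x * r * (poly S x * r)
           + poly P x * poly (pderiv S) x * r * r) * r ^ k * exp (- r)"
        unfolding rS by (cases k) (simp_all add: algebra_simps)
      also have "\<dots> = poly Q x * r ^ (k + 2) * exp (- r)"
        by (simp add: Q_def power2_eq_square algebra_simps)
      also have "\<dots> = bump Q (k + 2) x"
        using 1 by (simp add: bump_def S r_def divide_inverse power_inverse power_mult_distrib)
      finally have D: "((\<lambda>x. poly P x * inverse (poly S x) ^ k * exp (- inverse (poly S x)))
          has_real_derivative bump Q (k + 2) x) (at x)" .
      show ?thesis
        by (rule has_field_derivative_transform_within_open [OF D, of "{0<..<1}"])
           (use 1 in \<open>auto simp: bump_def S divide_inverse power_inverse power_mult_distrib\<close>)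
    next
      case 2
      then show ?thesis
        using DERIV_zero_if_quadratic_bound[of "bump P k" C x] C by (simp add: bump_def)
    next
      case 3
      then show ?thesis
        using DERIV_zero_if_quadratic_bound[of "bump P k" C x] C by (simp add: bump_def)
    next
      case 4
      have "((\<lambda>_. 0) has_real_derivative bump Q (k + 2) x) (at x)"
        using 4 by (simp add: bump_def)
      then show ?thesis
        by (rule has_field_derivative_transform_within_open [of _ _ _ "{..<0}"])
           (use 4 in \<open>auto simp: bump_def\<close>)
    next
      case 5
      have "((\<lambda>_. 0) has_real_derivative bump Q (k + 2) x) (at x)"
        using 5 by (simp add: bump_def)
      then show ?thesis
        by (rule has_field_derivative_transform_within_open [of _ _ _ "{1<..}"])
           (use 5 in \<open>auto simp: bump_def\<close>)
    qed
  qed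
  then show ?thesis
    by blast
qed

lemma smooth_step:
  obtains G :: "nat \<Rightarrow> real \<Rightarrow> real"
  where "\<And>k x. (G k has_real_derivative G (Suc k) x) (at x)"
    and "\<And>x. 0 < x \<Longrightarrow> x < 1 \<Longrightarrow> G 1 x > 0"
    and "\<And>x. x \<le> 0 \<or> 1 \<le> x \<Longrightarrow> G 1 x = 0"
    and "\<And>x. x \<le> 0 \<Longrightarrow> G 0 x = G 0 0"
    and "\<And>x. 1 \<le> x \<Longrightarrow> G 0 x = G 0 1"
proof -
  have "\<forall>v. \<exists>w. \<forall>x. (case_prod bump v has_real_derivative case_prod bump w x) (at x)"
    using DERIV_bump by (auto simp: case_prod_beta)
  then obtain D where
    D: "\<And>v x. (case_prod bump v has_real_derivative case_prod bump (D v) x) (at x)"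
    by metis
  define B where "B k = case_prod bump ((D ^^ k) (1, 0))" for k
  have B: "(B k has_real_derivative B (Suc k) x) (at x)" for k x
    using D[of "(D ^^ k) (1, 0)" x] by (simp add: B_def)
  have B0: "B 0 = bump 1 0"
    by (simp add: B_def)
  have "\<exists>F. \<forall>x. (F has_vector_derivative B 0 x) (at x)"
    using einterval_antiderivative[of "-\<infinity>" "\<infinity>" "B 0"] DERIV_isCont[OF B] by auto
  then obtain F where F: "\<And>x. (F has_real_derivative B 0 x) (at x)"
    unfolding has_real_derivative_iff_has_vector_derivative by blast
  define G where "G k = (case k of 0 \<Rightarrow> F | Suc j \<Rightarrow> B j)" for k
  have G: "(G k has_real_derivative G (Suc k) x) (at x)" for k x
    using F B by (auto simp: G_def split: nat.split)
  have G1: "G 1 = bump 1 0"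
    by (simp add: G_def B0)
  have dF: "((F has_real_derivative 0) (at x))" if "x \<le> 0 \<or> 1 \<le> x" for x
    using F[of x] that by (auto simp: B0 bump_def)
  show ?thesis
  proof (rule that)
    show "G 0 x = G 0 0" if "x \<le> 0" for x
      using DERIV_nonneg_imp_nondecreasing[of x 0 F] DERIV_nonpos_imp_nonincreasing[of x 0 F] dF that
      by (auto simp: G_def intro!: antisym)
    show "G 0 x = G 0 1" if "1 \<le> x" for x
    proof -
      have "\<exists>y. (F has_real_derivative y) (at u) \<and> y \<ge> 0"
        "\<exists>y. (F has_real_derivative y) (at u) \<and> y \<le> 0" if "1 \<le> u" for u
        using dF[of u] that by auto
      then show ?thesis
        using DERIV_nonneg_imp_nondecreasing[of 1 x F] DERIV_nonpos_imp_nonincreasing[of 1 x F] that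
        by (auto simp: G_def intro!: antisym)
    qed
    show "G 1 x > 0" if "0 < x" "x < 1" for x
      unfolding G1 bump_def using that by simp
    show "G 1 x = 0" if "x \<le> 0 \<or> 1 \<le> x" for x
      unfolding G1 bump_def using that by auto
  qed (rule G)
qed

lemma lborel_integral_eq_Icc:
  fixes g :: "real \<Rightarrow> real"
  assumes "continuous_on {a..b} g" "\<And>x. x \<notin> {a..b} \<Longrightarrow> g x = 0"
  shows "(LINT x|lborel. g x) = integral {a..b} g"
proof -
  have "(LINT x|lborel. g x) = (LINT x:{a..b}|lborel. g x)"
    unfolding set_lebesgue_integral_def
    by (rule Bochner_Integration.integral_cong) (use assms(2) in \<open>auto simp: indicator_def\<close>)
  also have "\<dots> = integral {a..b} g"
    by (rule set_borel_integral_eq_integral) (rule borel_integrable_atLeastAtMost' [OF assms(1)])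
  finally show ?thesis .
qed

text \<open>The test function below is a mollified indicator function of the interval between two
  points; its derivative is a positive bump near the first and a negative bump near the second.\<close>

lemma test_function_exists:
  fixes x y e :: real
  assumes "e > 0" "x + e \<le> y"
  obtains \<psi> \<psi>1 \<psi>2 where "test_function \<psi>" "(deriv ^^ 2) \<psi> = \<psi>2"
    and "\<And>t. (\<psi> has_real_derivative \<psi>1 t) (at t)"
    and "\<And>t. (\<psi>1 has_real_derivative \<psi>2 t) (at t)"
    and "continuous_on UNIV \<psi>2"
    and "\<And>t. t \<notin> {x..y + e} \<Longrightarrow> \<psi> t = 0 \<and> \<psi>1 t = 0 \<and> \<psi>2 t = 0"
    and "\<psi> x = 0" "\<psi> (y + e) = 0" "\<psi>1 x = 0" "\<psi>1 (y + e) = 0"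
    and "\<And>t. x < t \<Longrightarrow> t < x + e \<Longrightarrow> \<psi>1 t > 0"
    and "\<And>t. y < t \<Longrightarrow> t < y + e \<Longrightarrow> \<psi>1 t < 0"
    and "\<And>t. \<not> (x < t \<and> t < x + e) \<Longrightarrow> \<not> (y < t \<and> t < y + e) \<Longrightarrow> \<psi>1 t = 0"
proof -
  obtain G :: "nat \<Rightarrow> real \<Rightarrow> real" where
    G: "\<And>k x. (G k has_real_derivative G (Suc k) x) (at x)"
    and G1: "\<And>x. 0 < x \<Longrightarrow> x < 1 \<Longrightarrow> G 1 x > 0"
      "\<And>x. x \<le> 0 \<or> 1 \<le> x \<Longrightarrow> G 1 x = 0"
    and G0: "\<And>x. x \<le> 0 \<Longrightarrow> G 0 x = G 0 0" "\<And>x. 1 \<le> x \<Longrightarrow> G 0 x = G 0 1"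
    using smooth_step by blast
  define \<Psi> where "\<Psi> k t = (G k ((t - x) / e) - G k ((t - y) / e)) / e ^ k" for k t
  have D: "(\<Psi> k has_real_derivative \<Psi> (Suc k) t) (at t)" for k t
    unfolding \<Psi>_def using \<open>e > 0\<close>
    by (auto intro!: derivative_eq_intros DERIV_chain2 [OF G] simp: field_simps)
  have derivs: "(deriv ^^ k) (\<Psi> 0) = \<Psi> k" for k
    by (induction k) (auto intro!: ext DERIV_imp_deriv D)
  have out0: "\<Psi> 0 t = 0" if "t \<notin> {x<..<y + e}" for t
  proof -
    from that assms consider "t \<le> x" "t \<le> y" | "t \<ge> y + e" "t \<ge> x + e"
      by force
    then show ?thesis
    proof cases
      case 1
      with assms have "(t - x) / e \<le> 0" "(t - y) / e \<le> 0"
        by (auto simp: field_simps)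
      then show ?thesis
        using G0(1)[of "(t - x) / e"] G0(1)[of "(t - y) / e"] by (simp add: \<Psi>_def)
    next
      case 2
      with assms have "(t - x) / e \<ge> 1" "(t - y) / e \<ge> 1"
        by (auto simp: field_simps)
      then show ?thesis
        using G0(2)[of "(t - x) / e"] G0(2)[of "(t - y) / e"] by (simp add: \<Psi>_def)
    qed
  qed
  have \<Psi>1: "\<Psi> 1 t = (G 1 ((t - x) / e) - G 1 ((t - y) / e)) / e" for t
    by (simp add: \<Psi>_def)
  have gx: "G 1 ((t - x) / e) > 0" if "x < t" "t < x + e" for t x
    using that \<open>e > 0\<close> by (intro G1) (auto simp: field_simps)
  have gx0: "G 1 ((t - x) / e) = 0" if "\<not> (x < t \<and> t < x + e)" for t x
    using that \<open>e > 0\<close> by (intro G1) (auto simp: field_simps)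
  have out1: "\<Psi> 1 t = 0" if "t \<notin> {x<..<y + e}" for t
    unfolding \<Psi>1 using gx0[of x t] gx0[of y t] that assms by auto
  have out2: "\<Psi> 2 t = 0" if "t \<notin> {x..y + e}" for t
  proof -
    have "((\<lambda>_. 0) has_real_derivative 0) (at t)"
      by simp
    then have "(\<Psi> 1 has_real_derivative 0) (at t)"
      by (rule has_field_derivative_transform_within_open [of _ _ _ "- {x..y + e}"])
         (use that out1 in auto)
    then show ?thesis
      using D[of 1 t] by (metis DERIV_unique Suc_1)
  qed
  show ?thesis
  proof (rule that)
    show "test_function (\<Psi> 0)"
      unfolding test_function_def
    proof
      show "\<forall>k. (deriv ^^ k) (\<Psi> 0) differentiable_on UNIV"
        unfolding derivs differentiable_on_def
        using D real_differentiable_def by blast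
      have "{t. \<Psi> 0 t \<noteq> 0} \<subseteq> {x..y + e}"
      proof
        fix t assume "t \<in> {t. \<Psi> 0 t \<noteq> 0}"
        then have "t \<in> {x<..<y + e}"
          using out0[of t] by blast
        then show "t \<in> {x..y + e}"
          by simp
      qed
      then have "bounded {t. \<Psi> 0 t \<noteq> 0}"
        using bounded_subset bounded_closed_interval by blast
      then show "compact (closure {t. \<Psi> 0 t \<noteq> 0})"
        by simp
    qed
    show "(deriv ^^ 2) (\<Psi> 0) = \<Psi> 2"
      by (rule derivs)
    show "(\<Psi> 0 has_real_derivative \<Psi> 1 t) (at t)" "(\<Psi> 1 has_real_derivative \<Psi> 2 t) (at t)" for t
      using D[of 0] D[of 1] by (simp_all add: numeral_2_eq_2)
    show "continuous_on UNIV (\<Psi> 2)"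
      using DERIV_isCont[OF D[of 2]] by (simp add: continuous_at_imp_continuous_on)
    show "\<Psi> 1 t > 0" if "x < t" "t < x + e" for t
      unfolding \<Psi>1 using gx[OF that] gx0[of y t] that assms by simp
    show "\<Psi> 1 t < 0" if "y < t" "t < y + e" for t
      unfolding \<Psi>1 using gx[OF that] gx0[of x t] that assms by (simp add: divide_neg_pos)
    show "\<Psi> 1 t = 0" if "\<not> (x < t \<and> t < x + e)" "\<not> (y < t \<and> t < y + e)" for t
      unfolding \<Psi>1 using that gx0[of x t] gx0[of y t] by simp
  qed (use out0 out1 out2 assms in auto)
qed

section \<open>Regularity of weak solutions\<close>

lemma weak_second_deriv_continuous:
  fixes u u' v h :: "real \<Rightarrow> real"
  assumes weak: "has_weak_deriv 2 u v"
    and v: "v \<in> borel_measurable lborel"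
    and u: "\<And>x. (u has_real_derivative u' x) (at x)"
    and u': "continuous_on UNIV u'"
    and h: "continuous_on UNIV h"
    and ae: "AE x in lborel. s < x \<longrightarrow> v x = h x"
    and "s < x"
  shows "(u' has_real_derivative h x) (at x)"
proof -
  have "\<exists>H. \<forall>x. (H has_vector_derivative h x) (at x)"
    using einterval_antiderivative[of "-\<infinity>" "\<infinity>" h] h by (auto simp: continuous_on_eq_continuous_at)
  then obtain H where H: "\<And>x. (H has_real_derivative h x) (at x)"
    unfolding has_real_derivative_iff_has_vector_derivative by blast
  define r where "r x = u' x - H x" for x
  have contH: "continuous_on UNIV H"
    using DERIV_isCont[OF H] by (simp add: continuous_at_imp_continuous_on)
  have r: "continuous_on UNIV r"
    unfolding r_def by (intro continuous_intros u' contH)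
  have contu: "continuous_on UNIV u"
    using DERIV_isCont[OF u] by (simp add: continuous_at_imp_continuous_on)
  have const: "r a = r b" if "s < a" "a < b" for a b
  proof (rule ccontr)
    assume ne: "r a \<noteq> r b"
    define m where "m = (r a + r b) / 2"
    define \<sigma> where "\<sigma> = sgn (r b - r a)"
    have \<sigma>: "\<sigma> * (r a - m) < 0" "\<sigma> * (r b - m) > 0"
      using ne by (auto simp: \<sigma>_def m_def sgn_if field_simps)
    have "isCont (\<lambda>t. \<sigma> * (r t - m)) t" for t
      using r by (intro continuous_intros) (auto simp: continuous_on_eq_continuous_at)
    then have "(\<lambda>t. \<sigma> * (r t - m)) \<midarrow>a\<rightarrow> \<sigma> * (r a - m)" "(\<lambda>t. \<sigma> * (r t - m)) \<midarrow>b\<rightarrow> \<sigma> * (r b - m)"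
      by (auto simp: isCont_def)
    then have "\<forall>\<^sub>F t in at a. \<sigma> * (r t - m) < 0" "\<forall>\<^sub>F t in at b. \<sigma> * (r t - m) > 0"
      using \<sigma> by (auto dest: order_tendstoD)
    then obtain d1 d2 where d: "d1 > 0" "\<And>t. t \<noteq> a \<Longrightarrow> \<bar>t - a\<bar> < d1 \<Longrightarrow> \<sigma> * (r t - m) < 0"
      "d2 > 0" "\<And>t. t \<noteq> b \<Longrightarrow> \<bar>t - b\<bar> < d2 \<Longrightarrow> \<sigma> * (r t - m) > 0"
      unfolding eventually_at by (auto simp: dist_real_def)
    define e where "e = min (b - a) (min d1 d2)"
    have e: "e > 0" "a + e \<le> b" "e \<le> d1" "e \<le> d2"
      using d that by (auto simp: e_def)
    obtain \<psi> \<psi>1 \<psi>2 where \<psi>: "test_function \<psi>" "(deriv ^^ 2) \<psi> = \<psi>2"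
      and D: "\<And>t. (\<psi> has_real_derivative \<psi>1 t) (at t)"
        "\<And>t. (\<psi>1 has_real_derivative \<psi>2 t) (at t)"
      and cont2: "continuous_on UNIV \<psi>2"
      and out: "\<And>t. t \<notin> {a..b + e} \<Longrightarrow> \<psi> t = 0 \<and> \<psi>1 t = 0 \<and> \<psi>2 t = 0"
      and bd: "\<psi> a = 0" "\<psi> (b + e) = 0" "\<psi>1 a = 0" "\<psi>1 (b + e) = 0"
      and pos: "\<And>t. a < t \<Longrightarrow> t < a + e \<Longrightarrow> \<psi>1 t > 0"
      and neg: "\<And>t. b < t \<Longrightarrow> t < b + e \<Longrightarrow> \<psi>1 t < 0"
      and zero: "\<And>t. \<not> (a < t \<and> t < a + e) \<Longrightarrow> \<not> (b < t \<and> t < b + e) \<Longrightarrow> \<psi>1 t = 0"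
      by (rule test_function_exists[OF e(1,2)]) (rule that; assumption)
    let ?I = "{a..b + e}"
    have ab: "a \<le> b + e"
      using e that by simp
    have cont: "continuous_on UNIV \<psi>" "continuous_on UNIV \<psi>1"
      using DERIV_isCont[OF D(1)] DERIV_isCont[OF D(2)] by (simp_all add: continuous_at_imp_continuous_on)
    have cI: "continuous_on ?I g" if "continuous_on UNIV g" for g :: "real \<Rightarrow> real"
      using continuous_on_subset[OF that] by blast
    have "(LINT x|lborel. u x * \<psi>2 x) = (LINT x|lborel. v x * \<psi> x)"
      using weak \<psi> unfolding has_weak_deriv_def by auto
    also have "\<dots> = (LINT x|lborel. h x * \<psi> x)"
    proof (rule integral_cong_AE)
      show "AE x in lborel. v x * \<psi> x = h x * \<psi> x"
        using ae by eventually_elim (use out that in force)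
    qed (use v borel_measurable_continuous_onI[OF h] borel_measurable_continuous_onI[OF cont(1)] in auto)
    finally have "(LINT x|lborel. u x * \<psi>2 x) = (LINT x|lborel. h x * \<psi> x)" .
    moreover have c: "continuous_on ?I (\<lambda>t. u t * \<psi>2 t)" "continuous_on ?I (\<lambda>t. h t * \<psi> t)"
      by (intro cI continuous_on_mult contu cont2 h cont)+
    moreover have "(LINT x|lborel. u x * \<psi>2 x) = integral ?I (\<lambda>t. u t * \<psi>2 t)"
      by (rule lborel_integral_eq_Icc) (use c out in auto)
    moreover have "(LINT x|lborel. h x * \<psi> x) = integral ?I (\<lambda>t. h t * \<psi> t)"
      by (rule lborel_integral_eq_Icc) (use c out in auto)
    ultimately have eq: "integral ?I (\<lambda>t. u t * \<psi>2 t) = integral ?I (\<lambda>t. h t * \<psi> t)"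
      by simp
    have j: "((\<lambda>t. u t * \<psi>2 t - h t * \<psi> t) has_integral 0) ?I"
      using has_integral_diff[OF c[THEN integrable_continuous_real, THEN integrable_integral]]
      by (simp add: eq)
    define W where "W t = u t * \<psi>1 t - H t * \<psi> t" for t
    have "(W has_real_derivative (u' t * \<psi>1 t + u t * \<psi>2 t) - (h t * \<psi> t + H t * \<psi>1 t)) (at t within ?I)"
      for t unfolding W_def
      by (rule has_field_derivative_at_within)
         (auto intro!: derivative_eq_intros u D H simp: algebra_simps)
    then have "((\<lambda>t. (u' t * \<psi>1 t + u t * \<psi>2 t) - (h t * \<psi> t + H t * \<psi>1 t)) has_integral
        W (b + e) - W a) ?I"
      using ab
      by (intro fundamental_theorem_of_calculus)
         (auto simp flip: has_real_derivative_iff_has_vector_derivative)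
    from has_integral_diff[OF this j]
    have "((\<lambda>t. ((u' t * \<psi>1 t + u t * \<psi>2 t) - (h t * \<psi> t + H t * \<psi>1 t))
        - (u t * \<psi>2 t - h t * \<psi> t)) has_integral 0) ?I"
      by (simp add: W_def bd)
    then have i1: "((\<lambda>t. r t * \<psi>1 t) has_integral 0) ?I"
      by (rule has_integral_eq[rotated]) (auto simp: r_def algebra_simps)
    have "(\<psi>1 has_integral (\<psi> (b + e) - \<psi> a)) ?I"
      using ab
      by (intro fundamental_theorem_of_calculus)
         (auto simp flip: has_real_derivative_iff_has_vector_derivative
           intro!: D has_field_derivative_at_within)
    then have "((\<lambda>t. m * \<psi>1 t) has_integral m * 0) ?I"
      by (intro has_integral_mult_right) (simp add: bd)
    from has_integral_mult_right[OF has_integral_diff[OF i1 this], of "- \<sigma>"]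
    have i2: "((\<lambda>t. - \<sigma> * (r t * \<psi>1 t - m * \<psi>1 t)) has_integral 0) ?I"
      by simp
    have nonneg: "- \<sigma> * (r t * \<psi>1 t - m * \<psi>1 t) \<ge> 0" for t
    proof -
      have "- \<sigma> * (r t * \<psi>1 t - m * \<psi>1 t) = - (\<sigma> * (r t - m)) * \<psi>1 t"
        by (simp add: algebra_simps)
      also consider "a < t" "t < a + e" | "b < t" "t < b + e" | "\<psi>1 t = 0"
        using zero by blast
      then have "- (\<sigma> * (r t - m)) * \<psi>1 t \<ge> 0"
      proof cases
        case 1
        then show ?thesis
          using pos[OF 1] d(2)[of t] e by (intro mult_nonneg_nonneg) auto
      next
        case 2
        then show ?thesis
          using neg[OF 2] d(4)[of t] e by (intro mult_nonpos_nonpos) auto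
      qed simp
      finally show ?thesis .
    qed
    have "- \<sigma> * (r t * \<psi>1 t - m * \<psi>1 t) = 0" if "t \<in> ?I" for t
    proof -
      have "continuous_on ?I (\<lambda>t. - \<sigma> * (r t * \<psi>1 t - m * \<psi>1 t))"
        by (intro cI continuous_on_mult continuous_on_diff continuous_on_const r cont)
      then have "\<forall>t\<in>?I. - \<sigma> * (r t * \<psi>1 t - m * \<psi>1 t) = 0"
        using integral_eq_0_iff[THEN iffD1, OF _ _ _ integral_unique[OF i2]] nonneg e \<open>a < b\<close> by simp
      then show ?thesis
        using that by blast
    qed
    from this[of "a + e / 2"] have "\<sigma> * (r (a + e / 2) - m) * \<psi>1 (a + e / 2) = 0"
      using e by auto
    moreover have "\<sigma> * (r (a + e / 2) - m) < 0" "\<psi>1 (a + e / 2) > 0"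
      using e by (auto intro!: pos d(2))
    ultimately show False
      by auto
  qed
  define y where "y = (s + x) / 2"
  have y: "s < y" "y < x"
    using \<open>s < x\<close> by (auto simp: y_def)
  have "((\<lambda>x. H x + r y) has_real_derivative h x) (at x)"
    by (auto intro!: derivative_eq_intros H)
  then show ?thesis
    by (rule has_field_derivative_transform_within_open [of _ _ _ "{y<..}"])
       (use y const in \<open>auto simp: r_def\<close>)
qed

section \<open>Waves as classical solutions\<close>

lemma gronwall:
  fixes v :: "real \<Rightarrow> real"
  assumes "a \<le> b" and "e \<ge> 0" and "K \<ge> 0"
    and cont: "continuous_on {a..b} v"
    and der: "\<And>x. a < x \<Longrightarrow> x < b \<Longrightarrow> \<exists>d. (v has_real_derivative d) (at x) \<and> d \<le> K * v x + e"
  shows "v b \<le> (v a + e * (b - a)) * exp (K * (b - a))"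
proof -
  define w where "w x = v x * exp (- K * (x - a)) - e * (x - a)" for x
  have "w b \<le> w a"
  proof (rule DERIV_nonpos_imp_decreasing_open[of a b w])
    fix x assume x: "a < x" "x < b"
    then obtain d where d: "(v has_real_derivative d) (at x)" "d \<le> K * v x + e"
      using der by blast
    have "(w has_real_derivative (d - K * v x) * exp (- K * (x - a)) - e) (at x)"
      unfolding w_def by (auto intro!: derivative_eq_intros d simp: algebra_simps)
    moreover have "(d - K * v x) * exp (- K * (x - a)) \<le> e * 1"
      using d x assms by (intro mult_mono) auto
    ultimately show "\<exists>y. (w has_real_derivative y) (at x) \<and> y \<le> 0"
      by force
  next
    show "continuous_on {a..b} w"
      unfolding w_def by (intro continuous_intros cont)
  qed (rule \<open>a \<le> b\<close>)
  then have "v b * exp (- K * (b - a)) \<le> v a + e * (b - a)"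
    by (simp add: w_def)
  then have "v b * exp (- K * (b - a)) * exp (K * (b - a)) \<le> (v a + e * (b - a)) * exp (K * (b - a))"
    by (intro mult_right_mono) auto
  then show ?thesis
    by (simp add: mult.assoc flip: exp_add)
qed

locale bistable =
  fixes f :: "real \<Rightarrow> real" and a_minus a_zero a_plus :: real
  assumes C1: "f C1_differentiable_on UNIV"
    and order: "a_minus < a_zero" "a_zero < a_plus"
    and zeros: "f a_minus = 0" "f a_zero = 0" "f a_plus = 0"
    and f_pos: "\<And>z. a_minus < z \<Longrightarrow> z < a_zero \<Longrightarrow> f z > 0"
    and f_neg: "\<And>z. a_zero < z \<Longrightarrow> z < a_plus \<Longrightarrow> f z < 0"
begin

lemma continuous_f: "continuous_on A f"
  using C1_differentiable_imp_continuous_on[OF C1] continuous_on_subset by blast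

lemma isCont_f: "isCont f x"
  using continuous_f[of UNIV] by (simp add: continuous_on_eq_continuous_at)

lemma f_lipschitz:
  obtains K where "K \<ge> 0"
    "\<And>x y. x \<in> {a_minus..a_plus} \<Longrightarrow> y \<in> {a_minus..a_plus} \<Longrightarrow> \<bar>f x - f y\<bar> \<le> K * \<bar>x - y\<bar>"
proof -
  obtain D where D: "\<And>x. (f has_vector_derivative D x) (at x)" "continuous_on UNIV D"
    using C1 unfolding C1_differentiable_on_def by auto
  have "bounded (D ` {a_minus..a_plus})"
    by (intro compact_imp_bounded compact_continuous_image) (use continuous_on_subset[OF D(2)] in auto)
  then obtain K where K: "\<And>x. x \<in> {a_minus..a_plus} \<Longrightarrow> norm (D x) \<le> K"
    unfolding bounded_iff by blast
  have "\<bar>f x - f y\<bar> \<le> K * \<bar>x - y\<bar>" if "x \<in> {a_minus..a_plus}" "y \<in> {a_minus..a_plus}" for x y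
    using field_differentiable_bound[of "{a_minus..a_plus}" f D K x y] that D K
    by (simp add: has_real_derivative_iff_has_vector_derivative has_vector_derivative_at_within)
  moreover have "K \<ge> 0"
    using K[of a_minus] order by auto
  ultimately show ?thesis
    using that by blast
qed

end

locale wave = bistable +
  fixes \<alpha> c :: real and \<phi> \<phi>' :: "real \<Rightarrow> real"
  assumes \<alpha>: "a_minus < \<alpha>" "\<alpha> < a_zero"
    and left: "\<And>x. x \<le> 0 \<Longrightarrow> \<phi> x = \<alpha>"
    and right: "\<And>x. x > 0 \<Longrightarrow> \<phi> x > \<alpha>"
    and deriv_\<phi>: "\<And>x. (\<phi> has_real_derivative \<phi>' x) (at x)"
    and deriv_\<phi>': "\<And>x. x > 0 \<Longrightarrow> (\<phi>' has_real_derivative f (\<phi> x) - c * \<phi>' x) (at x)"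
    and cont_\<phi>': "continuous_on UNIV \<phi>'"
    and \<phi>'_nonneg: "\<And>x. \<phi>' x \<ge> 0"
    and \<phi>'_lim: "(\<phi>' \<longlongrightarrow> 0) at_top"
    and \<phi>_lim: "(\<phi> \<longlongrightarrow> a_plus) at_top"
begin

lemma cont_\<phi>: "continuous_on A \<phi>"
  using DERIV_isCont[OF deriv_\<phi>] by (simp add: continuous_at_imp_continuous_on)

lemma \<phi>_mono: "x \<le> y \<Longrightarrow> \<phi> x \<le> \<phi> y"
  using deriv_\<phi> \<phi>'_nonneg by (meson DERIV_nonneg_imp_nondecreasing)

lemma \<phi>_le: "\<phi> x \<le> a_plus"
  by (rule tendsto_lowerbound[OF \<phi>_lim])
     (auto intro: eventually_mono[OF eventually_ge_at_top[of x]] \<phi>_mono)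

lemma \<phi>_ge: "\<alpha> \<le> \<phi> x"
  using left right by (cases "x \<le> 0") (auto intro: less_imp_le)

lemma \<phi>_range: "\<phi> x \<in> {a_minus..a_plus}"
  using \<phi>_le[of x] \<phi>_ge[of x] \<alpha> by auto

lemma \<phi>'_0: "\<phi>' 0 = 0"
  by (rule DERIV_local_min[OF deriv_\<phi>, of 1]) (use \<phi>_ge left in auto)

text \<open>A critical point beyond the free boundary would be a zero of the reaction term, so the wave
  would coincide with a constant solution, by uniqueness for the initial value problem.\<close>

lemma \<phi>'_pos:
  assumes "x > 0"
  shows "\<phi>' x > 0"
proof (rule ccontr)
  assume "\<not> ?thesis"
  with \<phi>'_nonneg[of x] have crit: "\<phi>' x = 0"
    by simp
  have "f (\<phi> x) - c * \<phi>' x = 0"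
    by (rule DERIV_local_min[OF deriv_\<phi>'[OF assms], of 1]) (use crit \<phi>'_nonneg in auto)
  then have fx: "f (\<phi> x) = 0"
    by (simp add: crit)
  obtain K where K: "K \<ge> 0" and
    lip: "\<And>x y. x \<in> {a_minus..a_plus} \<Longrightarrow> y \<in> {a_minus..a_plus} \<Longrightarrow> \<bar>f x - f y\<bar> \<le> K * \<bar>x - y\<bar>"
    using f_lipschitz by blast
  define e where "e = \<phi> x"
  define M where "M = 1 + K + 2 * \<bar>c\<bar>"
  define v where "v y = (\<phi> y - e)\<^sup>2 + (\<phi>' y)\<^sup>2" for y
  define F where "F y = v y * exp (M * y)" for y
  have "F 0 \<le> F x"
  proof (rule DERIV_nonneg_imp_increasing_open[of 0 x F])
    fix y assume y: "0 < y" "y < x"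
    let ?d = "2 * (\<phi> y - e) * \<phi>' y + 2 * \<phi>' y * (f (\<phi> y) - c * \<phi>' y)"
    have "(F has_real_derivative (?d + M * v y) * exp (M * y)) (at y)"
      unfolding F_def v_def using y
      by (auto intro!: derivative_eq_intros deriv_\<phi> deriv_\<phi>' simp: algebra_simps)
    moreover have "?d + M * v y \<ge> 0"
    proof -
      have "\<bar>f (\<phi> y)\<bar> \<le> K * \<bar>\<phi> y - e\<bar>"
        using lip[OF \<phi>_range \<phi>_range, of y x] fx by (simp add: e_def)
      then have "\<bar>2 * \<phi>' y * f (\<phi> y)\<bar> \<le> 2 * \<bar>\<phi>' y\<bar> * (K * \<bar>\<phi> y - e\<bar>)"
        by (simp add: abs_mult mult_left_mono)
      also have "\<dots> = K * (2 * \<bar>\<phi> y - e\<bar> * \<bar>\<phi>' y\<bar>)"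
        by simp
      also have "\<dots> \<le> K * v y"
        using sum_squares_bound[of "\<bar>\<phi> y - e\<bar>" "\<bar>\<phi>' y\<bar>"] K unfolding v_def
        by (intro mult_left_mono) (auto simp: power2_eq_square)
      finally have 1: "2 * \<phi>' y * f (\<phi> y) \<ge> - (K * v y)"
        by linarith
      have 2: "2 * (\<phi> y - e) * \<phi>' y \<ge> - v y"
        using zero_le_power2[of "\<phi> y - e + \<phi>' y"] unfolding v_def
        by (simp add: power2_sum)
      have "2 * c * (\<phi>' y)\<^sup>2 \<le> 2 * \<bar>c\<bar> * v y"
        unfolding v_def by (rule mult_mono) auto
      with 1 2 show ?thesis
        by (simp add: M_def algebra_simps power2_eq_square)
    qed
    ultimately show "\<exists>d. (F has_real_derivative d) (at y) \<and> 0 \<le> d"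
      by (meson exp_ge_zero mult_nonneg_nonneg)
  next
    show "continuous_on {0..x} F"
      unfolding F_def v_def
      by (intro continuous_intros cont_\<phi> continuous_on_subset[OF cont_\<phi>']) auto
  qed (use assms in simp)
  then have "v 0 \<le> 0"
    by (simp add: F_def v_def e_def crit)
  then have "(\<phi> 0 - e)\<^sup>2 \<le> 0"
    unfolding v_def by (smt (verit) zero_le_power2)
  then have "\<phi> 0 = e"
    by simp
  with left[of 0] right[OF assms] show False
    by (simp add: e_def)
qed

lemma \<phi>_strict_mono:
  assumes "0 \<le> x" "x < y"
  shows "\<phi> x < \<phi> y"
  by (rule DERIV_pos_imp_increasing_open[OF assms(2)])
     (use assms deriv_\<phi> \<phi>'_pos cont_\<phi> in \<open>force+\<close>)

lemma \<phi>_less: "\<phi> x < a_plus"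
proof -
  have "\<phi> x \<le> \<phi> (max x 0)"
    by (rule \<phi>_mono) simp
  also have "\<dots> < \<phi> (max x 0 + 1)"
    by (rule \<phi>_strict_mono) auto
  also have "\<dots> \<le> a_plus"
    by (rule \<phi>_le)
  finally show ?thesis .
qed

end

section \<open>The phase plane\<close>

text \<open>Here p is the slope of a wave expressed through the value of the wave.\<close>

definition (in bistable) orbit :: "real \<Rightarrow> real \<Rightarrow> (real \<Rightarrow> real) \<Rightarrow> bool" where
  "orbit \<alpha> c p \<longleftrightarrow>
     (\<forall>z. \<alpha> < z \<and> z < a_plus \<longrightarrow> p z > 0 \<and> (p has_real_derivative f z / p z - c) (at z)) \<and>
     (p \<longlongrightarrow> 0) (at_right \<alpha>) \<and> (p \<longlongrightarrow> 0) (at_left a_plus)"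

lemma (in wave) ex_orbit: "\<exists>p. orbit \<alpha> c p"
proof -
  have ex: "\<exists>x>0. \<phi> x = z" if z: "\<alpha> < z" "z < a_plus" for z
  proof -
    have "eventually (\<lambda>x. z < \<phi> x \<and> x > 0) at_top"
      using order_tendstoD(1)[OF \<phi>_lim z(2)] eventually_gt_at_top[of 0] by (rule eventually_conj)
    then obtain y where y: "z < \<phi> y" "y > 0"
      using eventually_happens'[OF trivial_limit_at_top_linorder] by blast
    have "\<exists>x\<ge>0. x \<le> y \<and> \<phi> x = z"
      by (rule IVT') (use y z left[of 0] cont_\<phi> in auto)
    then obtain x where "x \<ge> 0" "\<phi> x = z"
      by blast
    moreover have "x \<noteq> 0"
      using \<open>\<phi> x = z\<close> z left[of 0] by auto
    ultimately show ?thesis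
      by (intro exI[of _ x]) auto
  qed
  define \<theta> where "\<theta> z = (SOME x. x > 0 \<and> \<phi> x = z)" for z
  have \<theta>: "\<theta> z > 0" "\<phi> (\<theta> z) = z" if "\<alpha> < z" "z < a_plus" for z
    using someI_ex[of "\<lambda>x. x > 0 \<and> \<phi> x = z"] ex[OF that] unfolding \<theta>_def by auto
  have less_iff: "\<phi> x < \<phi> y \<longleftrightarrow> x < y" if "x > 0" "y > 0" for x y
    using \<phi>_strict_mono[of x y] \<phi>_strict_mono[of y x] that by (metis less_imp_le linorder_neqE not_less_iff_gr_or_eq)
  have \<theta>_\<phi>: "\<theta> (\<phi> x) = x" if "x > 0" for x
    using \<theta>[OF right[OF that] \<phi>_less] less_iff[of x "\<theta> (\<phi> x)"] less_iff[of "\<theta> (\<phi> x)" x] that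
    by (metis less_irrefl linorder_neqE)
  have D\<theta>: "(\<theta> has_real_derivative inverse (\<phi>' (\<theta> z))) (at z)" if z: "\<alpha> < z" "z < a_plus" for z
  proof (rule DERIV_inverse_function[OF deriv_\<phi> _ z])
    show "\<phi>' (\<theta> z) \<noteq> 0"
      using \<phi>'_pos[OF \<theta>(1)[OF z]] by simp
    show "\<phi> (\<theta> y) = y" if "\<alpha> < y" "y < a_plus" for y
      by (rule \<theta>[OF that])
    have "isCont \<theta> (\<phi> (\<theta> z))"
    proof (rule isCont_inverse_function[where f = \<phi> and d = "\<theta> z / 2"])
      show "\<theta> (\<phi> x) = x" if "\<bar>x - \<theta> z\<bar> \<le> \<theta> z / 2" for x
        using \<theta>_\<phi>[of x] \<theta>(1)[OF z] that by (auto simp: abs_if split: if_splits)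
    qed (use \<theta>(1)[OF z] DERIV_isCont[OF deriv_\<phi>] in auto)
    then show "isCont \<theta> z"
      using \<theta>(2)[OF z] by simp
  qed
  define p where "p z = \<phi>' (\<theta> z)" for z
  have p: "p z > 0" "(p has_real_derivative f z / p z - c) (at z)" if z: "\<alpha> < z" "z < a_plus" for z
  proof -
    show pos: "p z > 0"
      using \<phi>'_pos[OF \<theta>(1)[OF z]] by (simp add: p_def)
    have "((\<lambda>z. \<phi>' (\<theta> z)) has_real_derivative
        (f (\<phi> (\<theta> z)) - c * \<phi>' (\<theta> z)) * inverse (\<phi>' (\<theta> z))) (at z)"
      by (rule DERIV_chain2[OF deriv_\<phi>'[OF \<theta>(1)[OF z]] D\<theta>[OF z]])
    then show "(p has_real_derivative f z / p z - c) (at z)"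
      using pos \<theta>(2)[OF z] unfolding p_def by (simp add: field_simps)
  qed
  have right_lim: "(p \<longlongrightarrow> 0) (at_right \<alpha>)"
  proof (rule tendstoI)
    fix e :: real assume "e > 0"
    have "isCont \<phi>' 0"
      using cont_\<phi>' by (simp add: continuous_on_eq_continuous_at)
    then obtain d where d: "d > 0" "\<And>x. \<bar>x\<bar> < d \<Longrightarrow> \<bar>\<phi>' x\<bar> < e"
      using \<open>e > 0\<close> \<phi>'_0 unfolding continuous_at_eps_delta by (auto simp: dist_real_def)
    have "dist (p z) 0 < e" if "\<alpha> < z" "z < \<phi> d" for z
    proof -
      have z: "\<alpha> < z" "z < a_plus"
        using that \<phi>_less[of d] by auto
      then have "\<theta> z < d"
        using less_iff[of "\<theta> z" d] \<theta>[of z] that d(1) by auto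
      with d(2)[of "\<theta> z"] \<theta>(1)[OF z] show ?thesis
        by (simp add: p_def)
    qed
    then show "eventually (\<lambda>z. dist (p z) 0 < e) (at_right \<alpha>)"
      using right[OF d(1)] unfolding eventually_at_right_field by blast
  qed
  have left_lim: "(p \<longlongrightarrow> 0) (at_left a_plus)"
  proof (rule tendstoI)
    fix e :: real assume "e > 0"
    with \<phi>'_lim have "eventually (\<lambda>x. dist (\<phi>' x) 0 < e) at_top"
      by (rule tendstoD)
    then obtain N where N: "\<And>x. x \<ge> N \<Longrightarrow> dist (\<phi>' x) 0 < e"
      unfolding eventually_at_top_linorder by blast
    define m where "m = max N 1"
    have "dist (p z) 0 < e" if "\<phi> m < z" "z < a_plus" for z
    proof -
      have z: "\<alpha> < z" "z < a_plus"
        using that \<phi>_ge[of m] by auto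
      then have "m < \<theta> z"
        using less_iff[of m "\<theta> z"] \<theta>[of z] that by (auto simp: m_def)
      with N[of "\<theta> z"] show ?thesis
        by (simp add: p_def m_def)
    qed
    then show "eventually (\<lambda>z. dist (p z) 0 < e) (at_left a_plus)"
      using \<phi>_less[of m] unfolding eventually_at_left_field by blast
  qed
  show ?thesis
    unfolding orbit_def using p right_lim left_lim by blast
qed

context bistable
begin

lemma orbit_pos: "orbit \<alpha> c p \<Longrightarrow> \<alpha> < z \<Longrightarrow> z < a_plus \<Longrightarrow> p z > 0"
  by (simp add: orbit_def)

lemma orbit_deriv:
  "orbit \<alpha> c p \<Longrightarrow> \<alpha> < z \<Longrightarrow> z < a_plus \<Longrightarrow> (p has_real_derivative f z / p z - c) (at z)"
  by (simp add: orbit_def)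

lemma orbit_isCont: "orbit \<alpha> c p \<Longrightarrow> \<alpha> < z \<Longrightarrow> z < a_plus \<Longrightarrow> isCont p z"
  using orbit_deriv DERIV_isCont by blast

lemma orbit_at_right: "orbit \<alpha> c p \<Longrightarrow> (p \<longlongrightarrow> 0) (at_right \<alpha>)"
  by (simp add: orbit_def)

lemma orbit_at_left: "orbit \<alpha> c p \<Longrightarrow> (p \<longlongrightarrow> 0) (at_left a_plus)"
  by (simp add: orbit_def)

lemma orbit_diff_deriv:
  assumes "orbit \<alpha> c p" "orbit \<beta> d q" "\<alpha> < z" "\<beta> < z" "z < a_plus"
  shows "((\<lambda>z. p z - q z) has_real_derivative (d - c) - f z / (p z * q z) * (p z - q z)) (at z)"
proof -
  have "p z > 0" "q z > 0"
    using assms orbit_pos by blast+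
  then have eq: "f z / p z - c - (f z / q z - d) = (d - c) - f z / (p z * q z) * (p z - q z)"
    by (simp add: field_simps)
  show ?thesis
    by (rule DERIV_cong[OF DERIV_diff[OF orbit_deriv[OF assms(1,3,5)] orbit_deriv[OF assms(2,4,5)]] eq])
qed

text \<open>The difference of two orbits solves a linear equation. With its integrating factor, a positive
  difference stays bounded away from zero up to the right end, where both orbits vanish.\<close>

lemma orbit_le:
  assumes p: "orbit \<alpha> c p" and q: "orbit \<beta> d q" and "c \<le> d"
    and z: "\<alpha> < z" "\<beta> < z" "z < a_plus"
  shows "p z \<le> q z"
proof (rule ccontr)
  assume neg: "\<not> p z \<le> q z"
  define \<gamma> where "\<gamma> = max \<alpha> \<beta>"
  define k where "k y = f y / (p y * q y)" for y
  have pos: "p y > 0" "q y > 0" if "\<gamma> < y" "y < a_plus" for y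
    using that orbit_pos[OF p] orbit_pos[OF q] by (auto simp: \<gamma>_def)
  have "isCont k y" if y: "\<gamma> < y" "y < a_plus" for y
    unfolding k_def using pos[OF y] y
    by (intro continuous_intros isCont_f orbit_isCont[OF p] orbit_isCont[OF q]) (auto simp: \<gamma>_def)
  moreover have "ereal \<gamma> < ereal a_plus"
    using z by (simp add: \<gamma>_def)
  ultimately obtain G where G: "\<And>y. \<gamma> < y \<Longrightarrow> y < a_plus \<Longrightarrow> (G has_real_derivative k y) (at y)"
    using einterval_antiderivative[of \<gamma> a_plus k]
    unfolding has_real_derivative_iff_has_vector_derivative by auto
  define F where "F y = (p y - q y) * exp (G y)" for y
  have F: "(F has_real_derivative (d - c) * exp (G y)) (at y)" if y: "\<gamma> < y" "y < a_plus" for y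
    unfolding F_def
    using DERIV_mult[OF orbit_diff_deriv[OF p q] DERIV_fun_exp[OF G[OF y]]] y
    by (simp add: \<gamma>_def k_def algebra_simps)
  define m where "m = max z a_zero"
  have m: "\<gamma> < m" "m < a_plus" "z \<le> m"
    using z order by (auto simp: m_def \<gamma>_def)
  define \<eta> where "\<eta> = F z * exp (- G m)"
  have "F z > 0"
    using neg by (simp add: F_def)
  then have "\<eta> > 0"
    by (simp add: \<eta>_def)
  have "p y - q y \<ge> \<eta>" if y: "m < y" "y < a_plus" for y
  proof -
    have "G y \<le> G m"
    proof (rule DERIV_nonpos_imp_nonincreasing[of m y G])
      fix x assume x: "m \<le> x" "x \<le> y"
      then have x': "\<gamma> < x" "x < a_plus" "a_zero \<le> x"
        using m y by (auto simp: m_def)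
      have "f x \<le> 0"
        using f_neg[of x] x' zeros by (cases "x = a_zero") auto
      then have "k x \<le> 0"
        unfolding k_def using pos[of x] x' by (intro divide_nonpos_pos) auto
      then show "\<exists>y. (G has_real_derivative y) (at x) \<and> y \<le> 0"
        using G x' by blast
    qed (use y in simp)
    moreover have "F z \<le> F y"
    proof (rule DERIV_nonneg_imp_nondecreasing[of z y F])
      fix x assume x: "z \<le> x" "x \<le> y"
      then have "\<gamma> < x" "x < a_plus"
        using z y by (auto simp: \<gamma>_def)
      then show "\<exists>y. (F has_real_derivative y) (at x) \<and> 0 \<le> y"
        using F[of x] \<open>c \<le> d\<close> by fastforce
    qed (use y m in simp)
    ultimately have "\<eta> \<le> F y * exp (- G y)"
      using \<open>F z > 0\<close> unfolding \<eta>_def by (intro mult_mono) auto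
    then show ?thesis
      by (simp add: F_def mult.assoc flip: exp_add)
  qed
  then have "eventually (\<lambda>y. \<eta> \<le> p y - q y) (at_left a_plus)"
    using m(2) unfolding eventually_at_left_field by blast
  moreover have "((\<lambda>y. p y - q y) \<longlongrightarrow> 0) (at_left a_plus)"
    using tendsto_diff[OF orbit_at_left[OF p] orbit_at_left[OF q]] by simp
  ultimately have "\<eta> \<le> 0"
    by (intro tendsto_lowerbound[of "\<lambda>y. p y - q y" 0 "at_left a_plus"]) auto
  with \<open>\<eta> > 0\<close> show False
    by simp
qed

lemma orbit_gap:
  assumes p: "orbit \<alpha> c p" and q: "orbit \<beta> d q" and "c \<le> d"
    and z: "\<alpha> < z" "\<beta> < z" "a_minus < z" "z < a_zero"
  shows "(d - c) * (a_zero - z) \<le> q z - p z"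
proof -
  define F where "F y = p y - q y - (d - c) * y" for y
  have "F z \<le> F a_zero"
  proof (rule DERIV_nonneg_imp_nondecreasing[of z a_zero F])
    fix y assume y: "z \<le> y" "y \<le> a_zero"
    then have y': "\<alpha> < y" "\<beta> < y" "a_minus < y" "y < a_plus"
      using z order by auto
    have "f y \<ge> 0"
      using f_pos[of y] y y' zeros by (cases "y = a_zero") auto
    then have "f y / (p y * q y) \<ge> 0"
      using orbit_pos[OF p, of y] orbit_pos[OF q, of y] y' by simp
    moreover have "p y - q y \<le> 0"
      using orbit_le[OF p q \<open>c \<le> d\<close>, of y] y' by simp
    ultimately have "f y / (p y * q y) * (p y - q y) \<le> 0"
      by (rule mult_nonneg_nonpos)
    then have "- (f y / (p y * q y) * (p y - q y)) \<ge> 0"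
      by linarith
    moreover have "(F has_real_derivative ((d - c) - f y / (p y * q y) * (p y - q y)) - (d - c)) (at y)"
      unfolding F_def by (intro DERIV_diff orbit_diff_deriv[OF p q] DERIV_cmult_Id y')
    then have "(F has_real_derivative - (f y / (p y * q y) * (p y - q y))) (at y)"
      by simp
    ultimately show "\<exists>D. (F has_real_derivative D) (at y) \<and> 0 \<le> D"
      by blast
  qed (use z in simp)
  moreover have "p a_zero \<le> q a_zero"
    using orbit_le[OF p q \<open>c \<le> d\<close>, of a_zero] z order by simp
  ultimately show ?thesis
    by (simp add: F_def algebra_simps)
qed

lemma eventually_at_right_between:
  fixes a b :: real
  assumes "a < b"
  shows "eventually (\<lambda>z. a < z \<and> z < b) (at_right a)"
  using assms unfolding eventually_at_right_field by blast

lemma orbit_speed_unique: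
  assumes p: "orbit \<alpha> c p" and q: "orbit \<alpha> d q" and \<alpha>: "a_minus < \<alpha>" "\<alpha> < a_zero"
  shows "c = d"
proof -
  have *: "d \<le> c" if p: "orbit \<alpha> c p" and q: "orbit \<alpha> d q" and "c \<le> d" for c d p q
  proof -
    have "((\<lambda>z. q z - p z) \<longlongrightarrow> 0) (at_right \<alpha>)"
      using tendsto_diff[OF orbit_at_right[OF q] orbit_at_right[OF p]] by simp
    moreover have "((\<lambda>z. (d - c) * (a_zero - z)) \<longlongrightarrow> (d - c) * (a_zero - \<alpha>)) (at_right \<alpha>)"
      by (intro tendsto_intros)
    moreover have "eventually (\<lambda>z. (d - c) * (a_zero - z) \<le> q z - p z) (at_right \<alpha>)"
      by (rule eventually_mono[OF eventually_at_right_between[OF \<alpha>(2)]])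
         (use \<alpha> in \<open>auto intro!: orbit_gap[OF p q \<open>c \<le> d\<close>]\<close>)
    ultimately have "(d - c) * (a_zero - \<alpha>) \<le> 0"
      by (rule tendsto_le[rotated]) simp
    then show ?thesis
      using \<alpha> by (simp add: mult_le_0_iff)
  qed
  from *[OF p q] *[OF q p] show ?thesis
    by linarith
qed

lemma orbit_speed_less:
  assumes p: "orbit \<alpha> c p" and q: "orbit \<beta> d q" and "\<alpha> < \<beta>" "\<beta> < a_zero"
  shows "d < c"
proof (rule ccontr)
  assume "\<not> ?thesis"
  then have "c \<le> d"
    by simp
  have \<beta>: "\<beta> < a_plus"
    using assms order by simp
  have "eventually (\<lambda>z. p z \<le> q z) (at_right \<beta>)"
    by (rule eventually_mono[OF eventually_at_right_between[OF \<beta>]])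
       (use \<open>\<alpha> < \<beta>\<close> in \<open>auto intro!: orbit_le[OF p q \<open>c \<le> d\<close>]\<close>)
  moreover have "(p \<longlongrightarrow> p \<beta>) (at_right \<beta>)"
    using orbit_isCont[OF p \<open>\<alpha> < \<beta>\<close> \<beta>] by (simp add: isCont_def filterlim_at_split)
  ultimately have "p \<beta> \<le> 0"
    using orbit_at_right[OF q] by (intro tendsto_le[of "at_right \<beta>" q 0 p "p \<beta>"]) auto
  with orbit_pos[OF p \<open>\<alpha> < \<beta>\<close> \<beta>] show False
    by simp
qed

lemma orbit_speed_modulus:
  assumes p: "orbit \<alpha> c p" and q: "orbit \<beta> d q" and "a_minus < \<alpha>" "\<alpha> < \<beta>" "\<beta> < a_zero"
  shows "(c - d) * (a_zero - \<beta>) \<le> p \<beta>"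
proof -
  have "d < c"
    using assms by (intro orbit_speed_less[OF p q])
  have "eventually (\<lambda>z. (c - d) * (a_zero - z) \<le> p z) (at_right \<beta>)"
  proof (rule eventually_mono[OF eventually_at_right_between[OF \<open>\<beta> < a_zero\<close>]])
    fix z assume z: "\<beta> < z \<and> z < a_zero"
    then have "(c - d) * (a_zero - z) \<le> p z - q z"
      using assms \<open>d < c\<close> by (intro orbit_gap[OF q p]) auto
    also have "\<dots> \<le> p z"
      using orbit_pos[OF q, of z] z order by simp
    finally show "(c - d) * (a_zero - z) \<le> p z" .
  qed
  moreover have "(p \<longlongrightarrow> p \<beta>) (at_right \<beta>)"
    using orbit_isCont[OF p \<open>\<alpha> < \<beta>\<close>] assms order by (simp add: isCont_def filterlim_at_split)
  moreover have "((\<lambda>z. (c - d) * (a_zero - z)) \<longlongrightarrow> (c - d) * (a_zero - \<beta>)) (at_right \<beta>)"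
    by (intro tendsto_intros)
  ultimately show ?thesis
    by (intro tendsto_le[of "at_right \<beta>" p "p \<beta>" "\<lambda>z. (c - d) * (a_zero - z)"]) auto
qed

lemma orbit_square_bound:
  assumes p: "orbit \<alpha> c p" and \<alpha>: "\<alpha> < \<beta>" "\<beta> < a_plus"
    and M: "M \<ge> 0" "\<And>z. \<alpha> < z \<Longrightarrow> z < \<beta> \<Longrightarrow> f z \<le> M"
    and C: "C \<ge> 0" "- c \<le> C"
  shows "(p \<beta>)\<^sup>2 \<le> exp ((2 * M + C) * (\<beta> - \<alpha>)) - 1"
proof -
  define K where "K = 2 * M + C"
  have "(p \<beta>)\<^sup>2 + 1 \<le> ((p x)\<^sup>2 + 1) * exp (K * (\<beta> - x))" if x: "\<alpha> < x" "x < \<beta>" for x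
  proof -
    have "(p \<beta>)\<^sup>2 + 1 \<le> (((p x)\<^sup>2 + 1) + 0 * (\<beta> - x)) * exp (K * (\<beta> - x))"
    proof (rule gronwall)
      have "isCont p y" if "y \<in> {x..\<beta>}" for y
        using that x \<alpha> by (intro orbit_isCont[OF p]) auto
      then have "continuous_on {x..\<beta>} p"
        by (simp add: continuous_at_imp_continuous_on)
      then show "continuous_on {x..\<beta>} (\<lambda>y. (p y)\<^sup>2 + 1)"
        by (intro continuous_intros)
      fix y assume "x < y" "y < \<beta>"
      with x \<alpha> have y: "\<alpha> < y" "y < a_plus" "y < \<beta>"
        by auto
      have pos: "p y > 0"
        using orbit_pos[OF p] y by simp
      have "((\<lambda>y. (p y)\<^sup>2 + 1) has_real_derivative 2 * f y + (- c) * (2 * p y)) (at y)"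
        using pos by (auto intro!: derivative_eq_intros orbit_deriv[OF p] y simp: field_simps power2_eq_square)
      moreover have "(- c) * (2 * p y) \<le> C * (2 * p y)"
        using pos C by (intro mult_right_mono) auto
      moreover have "C * (2 * p y) \<le> C * ((p y)\<^sup>2 + 1)"
        using C sum_squares_bound[of "p y" 1] by (intro mult_left_mono) (auto simp: power2_eq_square)
      moreover have "2 * f y \<le> 2 * M * ((p y)\<^sup>2 + 1)"
        using M y mult_left_mono[of 1 "(p y)\<^sup>2 + 1" "2 * M"] by fastforce
      ultimately show "\<exists>D. ((\<lambda>y. (p y)\<^sup>2 + 1) has_real_derivative D) (at y)
          \<and> D \<le> K * ((p y)\<^sup>2 + 1) + 0"
        by (intro exI[of _ "2 * f y + (- c) * (2 * p y)"]) (simp add: K_def algebra_simps)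
    qed (use x M C in \<open>auto simp: K_def\<close>)
    then show ?thesis
      by simp
  qed
  then have "eventually (\<lambda>x. (p \<beta>)\<^sup>2 + 1 \<le> ((p x)\<^sup>2 + 1) * exp (K * (\<beta> - x))) (at_right \<alpha>)"
    by (intro eventually_mono[OF eventually_at_right_between[OF \<alpha>(1)]]) auto
  moreover have "((\<lambda>x. ((p x)\<^sup>2 + 1) * exp (K * (\<beta> - x))) \<longlongrightarrow> (0\<^sup>2 + 1) * exp (K * (\<beta> - \<alpha>))) (at_right \<alpha>)"
    by (intro tendsto_intros orbit_at_right[OF p])
  ultimately have "(p \<beta>)\<^sup>2 + 1 \<le> (0\<^sup>2 + 1) * exp (K * (\<beta> - \<alpha>))"
    by (intro tendsto_lowerbound[of _ _ "at_right \<alpha>"]) auto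
  then show ?thesis
    by (simp add: K_def)
qed

end

section \<open>Dependence of the profile on the data\<close>

context bistable
begin

lemma wave_of_degenerate_wave:
  assumes wave: "degenerate_wave f a_plus \<alpha> c \<phi>"
    and \<alpha>: "a_minus < \<alpha>" "\<alpha> < a_zero"
    and s: "\<And>\<xi>. \<xi> \<le> s \<Longrightarrow> \<phi> \<xi> = \<alpha>" "\<And>\<xi>. \<xi> > s \<Longrightarrow> \<phi> \<xi> > \<alpha>"
  shows "wave f a_minus a_zero a_plus \<alpha> c (\<lambda>x. \<phi> (x + s)) (\<lambda>x. deriv \<phi> (x + s))"
proof -
  from wave obtain D where D: "\<And>x. (\<phi> has_real_derivative D x) (at x)" and contD: "continuous_on UNIV D"
    unfolding degenerate_wave_def C1_differentiable_on_def has_real_derivative_iff_has_vector_derivative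
    by auto
  have D_eq: "deriv \<phi> = D"
    by (intro ext DERIV_imp_deriv D)
  have cont: "continuous_on UNIV \<phi>"
    using DERIV_isCont[OF D] by (simp add: continuous_at_imp_continuous_on)
  from wave obtain \<phi>2 where \<phi>2: "\<phi>2 \<in> L_infty" "has_weak_deriv 2 \<phi> \<phi>2"
    and ae: "AE \<xi> in lborel. \<exists>g\<in>subdiff_indicator \<alpha> (\<phi> \<xi>). - c * deriv \<phi> \<xi> - \<phi>2 \<xi> + g + f (\<phi> \<xi>) = 0"
    unfolding degenerate_wave_def by blast
  have D': "(D has_real_derivative f (\<phi> x) - c * D x) (at x)" if "s < x" for x
  proof (rule weak_second_deriv_continuous[OF \<phi>2(2) _ D contD _ _ that])
    show "\<phi>2 \<in> borel_measurable lborel"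
      using \<phi>2(1) by (simp add: L_infty_def)
    show "continuous_on UNIV (\<lambda>x. f (\<phi> x) - c * D x)"
      by (intro continuous_intros contD continuous_on_compose2[OF continuous_f cont]) auto
    show "AE x in lborel. s < x \<longrightarrow> \<phi>2 x = f (\<phi> x) - c * D x"
      using ae by eventually_elim (use s(2) in \<open>auto simp: subdiff_indicator_def D_eq\<close>)
  qed
  have shift: "filterlim (\<lambda>x. x + s) at_top at_top"
    using filterlim_tendsto_add_at_top[OF tendsto_const filterlim_ident, of s] by (simp add: add.commute)
  show ?thesis
  proof unfold_locales
    show "((\<lambda>x. deriv \<phi> (x + s)) \<longlongrightarrow> 0) at_top" "((\<lambda>x. \<phi> (x + s)) \<longlongrightarrow> a_plus) at_top"
      using wave unfolding degenerate_wave_def by (auto intro: filterlim_compose[OF _ shift])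
    show "((\<lambda>x. \<phi> (x + s)) has_real_derivative deriv \<phi> (x + s)) (at x)" for x
      using D[of "x + s"] by (simp add: D_eq DERIV_shift)
    show "((\<lambda>x. deriv \<phi> (x + s)) has_real_derivative f (\<phi> (x + s)) - c * deriv \<phi> (x + s)) (at x)"
      if "x > 0" for x
      using D'[of "x + s"] that by (simp add: D_eq DERIV_shift)
    show "continuous_on UNIV (\<lambda>x. deriv \<phi> (x + s))"
      unfolding D_eq by (intro continuous_on_compose2[OF contD] continuous_intros) auto
    show "deriv \<phi> (x + s) \<ge> 0" for x
      using wave unfolding degenerate_wave_def by blast
  qed (use \<alpha> s in auto)
qed

lemma wave_of_normalized:
  assumes "degenerate_wave f a_plus \<alpha> c \<phi>" "normalized_profile \<alpha> \<phi>" "a_minus < \<alpha>" "\<alpha> < a_zero"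
  shows "wave f a_minus a_zero a_plus \<alpha> c \<phi> (deriv \<phi>)"
  using wave_of_degenerate_wave[OF assms(1,3,4), of 0] assms(2) by (simp add: normalized_profile_def)

lemma degenerate_wave_shift:
  assumes "degenerate_wave f a_plus \<alpha> c \<phi>" "a_minus < \<alpha>" "\<alpha> < a_zero"
  obtains s where "wave f a_minus a_zero a_plus \<alpha> c (\<lambda>x. \<phi> (x + s)) (\<lambda>x. deriv \<phi> (x + s))"
proof -
  from assms(1) obtain s where "\<forall>\<xi>\<le>s. \<phi> \<xi> = \<alpha>" "\<forall>\<xi>>s. \<phi> \<xi> > \<alpha>"
    unfolding degenerate_wave_def by blast
  then show ?thesis
    using wave_of_degenerate_wave[OF assms, of s] that by blast
qed

lemma degenerate_wave_orbit:
  assumes "degenerate_wave f a_plus \<alpha> c \<phi>" "a_minus < \<alpha>" "\<alpha> < a_zero"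
  obtains p where "orbit \<alpha> c p"
proof -
  obtain s where "wave f a_minus a_zero a_plus \<alpha> c (\<lambda>x. \<phi> (x + s)) (\<lambda>x. deriv \<phi> (x + s))"
    using degenerate_wave_shift[OF assms] by blast
  then show ?thesis
    using wave.ex_orbit that by blast
qed

lemma wave_distance:
  assumes w1: "wave f a_minus a_zero a_plus \<alpha> c \<phi> \<phi>'"
    and w2: "wave f a_minus a_zero a_plus \<beta> d \<psi> \<psi>'"
    and K: "K \<ge> 0"
    and lip: "\<And>x y. x \<in> {a_minus..a_plus} \<Longrightarrow> y \<in> {a_minus..a_plus} \<Longrightarrow> \<bar>f x - f y\<bar> \<le> K * \<bar>x - y\<bar>"
    and B: "\<And>y. 0 \<le> y \<Longrightarrow> y \<le> x \<Longrightarrow> \<bar>\<psi>' y\<bar> \<le> B"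
    and C: "\<bar>c\<bar> \<le> C" and x: "0 \<le> x"
  shows "(\<phi> x - \<psi> x)\<^sup>2 + (\<phi>' x - \<psi>' x)\<^sup>2
    \<le> ((\<alpha> - \<beta>)\<^sup>2 + (c - d)\<^sup>2 * B\<^sup>2 * x) * exp ((2 + K + 2 * C) * x)"
proof -
  interpret w1: wave f a_minus a_zero a_plus \<alpha> c \<phi> \<phi>' by (rule w1)
  interpret w2: wave f a_minus a_zero a_plus \<beta> d \<psi> \<psi>' by (rule w2)
  define v where "v y = (\<phi> y - \<psi> y)\<^sup>2 + (\<phi>' y - \<psi>' y)\<^sup>2" for y
  have "v x \<le> (v 0 + (c - d)\<^sup>2 * B\<^sup>2 * (x - 0)) * exp ((2 + K + 2 * C) * (x - 0))"
  proof (rule gronwall)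
    show "continuous_on {0..x} v"
      unfolding v_def
      by (intro continuous_intros w1.cont_\<phi> w2.cont_\<phi> continuous_on_subset[OF w1.cont_\<phi>']
          continuous_on_subset[OF w2.cont_\<phi>']) auto
    fix y assume y: "0 < y" "y < x"
    define u where "u = \<phi> y - \<psi> y"
    define w where "w = \<phi>' y - \<psi>' y"
    define g where "g = f (\<phi> y) - f (\<psi> y)"
    have vy: "v y = u\<^sup>2 + w\<^sup>2"
      by (simp add: v_def u_def w_def)
    let ?D = "2 * u * w + 2 * w * (g - c * w - (c - d) * \<psi>' y)"
    have "(v has_real_derivative ?D) (at y)"
      unfolding v_def using y
      by (auto intro!: derivative_eq_intros w1.deriv_\<phi> w2.deriv_\<phi> w1.deriv_\<phi>' w2.deriv_\<phi>'
          simp: u_def w_def g_def algebra_simps)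
    moreover have "?D \<le> (2 + K + 2 * C) * v y + (c - d)\<^sup>2 * B\<^sup>2"
    proof -
      have "\<bar>g\<bar> \<le> K * \<bar>u\<bar>"
        unfolding g_def u_def by (intro lip w1.\<phi>_range w2.\<phi>_range)
      then have "\<bar>w\<bar> * \<bar>g\<bar> \<le> \<bar>w\<bar> * (K * \<bar>u\<bar>)"
        by (intro mult_left_mono) auto
      then have "2 * w * g \<le> K * (2 * \<bar>u\<bar> * \<bar>w\<bar>)"
        using abs_ge_self[of "w * g"] by (simp add: abs_mult algebra_simps)
      also have "\<dots> \<le> K * v y"
        using sum_squares_bound[of "\<bar>u\<bar>" "\<bar>w\<bar>"] K unfolding vy by (intro mult_left_mono) auto
      finally have 1: "2 * w * g \<le> K * v y" .
      have 2: "2 * u * w \<le> v y"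
        using sum_squares_bound[of u w] by (simp add: vy)
      have "- c * w\<^sup>2 \<le> C * w\<^sup>2"
        using C by (intro mult_right_mono) auto
      also have "\<dots> \<le> C * v y"
        using C unfolding vy by (intro mult_left_mono) auto
      finally have 3: "- c * w\<^sup>2 \<le> C * v y" .
      have "- (2 * w * ((c - d) * \<psi>' y)) \<le> w\<^sup>2 + ((c - d) * \<psi>' y)\<^sup>2"
        using zero_le_power2[of "w + (c - d) * \<psi>' y"] unfolding power2_sum by linarith
      also have "((c - d) * \<psi>' y)\<^sup>2 \<le> (c - d)\<^sup>2 * B\<^sup>2"
        unfolding power_mult_distrib using B[of y] y
        by (intro mult_left_mono abs_le_square_iff[THEN iffD1]) auto
      also have "w\<^sup>2 \<le> v y"
        by (simp add: vy)
      finally have 4: "- (2 * w * ((c - d) * \<psi>' y)) \<le> v y + (c - d)\<^sup>2 * B\<^sup>2"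
        by simp
      have "?D = 2 * w * g + 2 * u * w + 2 * (- c * w\<^sup>2) + - (2 * w * ((c - d) * \<psi>' y))"
        by (simp add: algebra_simps power2_eq_square)
      also have "\<dots> \<le> K * v y + v y + 2 * (C * v y) + (v y + (c - d)\<^sup>2 * B\<^sup>2)"
        using 1 2 3 4 by linarith
      finally show ?thesis
        by (simp add: algebra_simps)
    qed
    ultimately show "\<exists>D. (v has_real_derivative D) (at y) \<and> D \<le> (2 + K + 2 * C) * v y + (c - d)\<^sup>2 * B\<^sup>2"
      by blast
  qed (use x K C in auto)
  then show ?thesis
    by (simp add: v_def w1.left w2.left w1.\<phi>'_0 w2.\<phi>'_0)
qed

lemma wave_slope_bounded:
  assumes "wave f a_minus a_zero a_plus \<alpha> c \<phi> \<phi>'"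
  obtains B where "\<And>y. 0 \<le> y \<Longrightarrow> y \<le> x \<Longrightarrow> \<bar>\<phi>' y\<bar> \<le> B"
proof -
  interpret wave f a_minus a_zero a_plus \<alpha> c \<phi> \<phi>' by (rule assms)
  have "bounded (\<phi>' ` {0..x})"
    by (intro compact_imp_bounded compact_continuous_image continuous_on_subset[OF cont_\<phi>']) auto
  then obtain B where "\<forall>y\<in>{0..x}. norm (\<phi>' y) \<le> B"
    unfolding bounded_iff by blast
  then show ?thesis
    by (intro that[of B]) auto
qed

lemma wave_profile_unique:
  assumes w1: "wave f a_minus a_zero a_plus \<alpha> c \<phi> \<phi>'"
    and w2: "wave f a_minus a_zero a_plus \<alpha> c \<psi> \<psi>'"
  shows "\<phi> x = \<psi> x"
proof (cases "x \<le> 0")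
  case True
  then show ?thesis
    using wave.left[OF w1] wave.left[OF w2] by simp
next
  case False
  obtain K where K: "K \<ge> 0"
    "\<And>x y. x \<in> {a_minus..a_plus} \<Longrightarrow> y \<in> {a_minus..a_plus} \<Longrightarrow> \<bar>f x - f y\<bar> \<le> K * \<bar>x - y\<bar>"
    using f_lipschitz by blast
  obtain B where B: "\<And>y. 0 \<le> y \<Longrightarrow> y \<le> x \<Longrightarrow> \<bar>\<psi>' y\<bar> \<le> B"
    using wave_slope_bounded[OF w2] by blast
  have "(\<phi> x - \<psi> x)\<^sup>2 + (\<phi>' x - \<psi>' x)\<^sup>2 \<le> 0"
    using wave_distance[OF w1 w2 K B order_refl] False by simp
  then have "(\<phi> x - \<psi> x)\<^sup>2 \<le> 0"
    by (smt (verit) zero_le_power2)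
  then show ?thesis
    by simp
qed

lemma speed_difference_bound:
  assumes p: "orbit \<alpha> c p" and q: "orbit \<beta> d q"
    and ab: "a_minus < \<alpha>" "\<alpha> < a_zero" "a_minus < \<beta>" "\<beta> < a_zero"
    and M: "M \<ge> 0" "\<And>z. a_minus < z \<Longrightarrow> z < a_zero \<Longrightarrow> f z \<le> M"
  shows "\<bar>c - d\<bar> * (a_zero - max \<alpha> \<beta>) \<le> sqrt (exp ((2 * M + \<bar>d\<bar>) * \<bar>\<alpha> - \<beta>\<bar>) - 1)"
proof -
  have *: "(c - d) * (a_zero - \<beta>) \<le> sqrt (exp ((2 * M + C) * (\<beta> - \<alpha>)) - 1)"
    if "orbit \<alpha> c p" "orbit \<beta> d q" "\<alpha> < \<beta>" "a_minus < \<alpha>" "\<beta> < a_zero" "C \<ge> 0" "- c \<le> C"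
    for \<alpha> \<beta> c d p q C
  proof -
    have "(p \<beta>)\<^sup>2 \<le> exp ((2 * M + C) * (\<beta> - \<alpha>)) - 1"
      using that M order by (intro orbit_square_bound[of \<alpha> c]) auto
    then have "p \<beta> \<le> sqrt (exp ((2 * M + C) * (\<beta> - \<alpha>)) - 1)"
      by (rule real_le_rsqrt)
    with orbit_speed_modulus[of \<alpha> c p \<beta> d q] that show ?thesis
      by simp
  qed
  consider "\<alpha> < \<beta>" | "\<alpha> = \<beta>" | "\<beta> < \<alpha>"
    by linarith
  then show ?thesis
  proof cases
    case 1
    have "d < c"
      by (rule orbit_speed_less[OF p q 1 ab(4)])
    then show ?thesis
      using *[OF p q 1, of "\<bar>d\<bar>"] 1 ab by auto
  next
    case 2
    then show ?thesis
      using orbit_speed_unique[OF p _ ab(1,2)] q by simp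
  next
    case 3
    have "c < d"
      by (rule orbit_speed_less[OF q p 3 ab(2)])
    then show ?thesis
      using *[OF q p 3, of "\<bar>d\<bar>"] 3 ab by auto
  qed
qed

lemma f_bounded_above:
  obtains M where "M \<ge> 0" "\<And>z. a_minus < z \<Longrightarrow> z < a_zero \<Longrightarrow> f z \<le> M"
proof -
  obtain M where "\<forall>z\<in>{a_minus..a_zero}. f z \<le> f M" "M \<in> {a_minus..a_zero}"
    using continuous_attains_sup[of "{a_minus..a_zero}" f] continuous_f order by auto
  then show ?thesis
    using zeros order by (intro that[of "f M"]) (auto dest: bspec[of _ _ a_minus])
qed

lemma speed_continuous:
  assumes p: "\<And>n. orbit (\<alpha>s n) (cs n) (p n)" and q: "orbit \<alpha> c q"
    and \<alpha>s: "\<And>n. a_minus < \<alpha>s n \<and> \<alpha>s n < a_zero" and \<alpha>: "a_minus < \<alpha>" "\<alpha> < a_zero"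
    and lim: "\<alpha>s \<longlonglongrightarrow> \<alpha>"
  shows "cs \<longlonglongrightarrow> c"
proof -
  obtain M where M: "M \<ge> 0" "\<And>z. a_minus < z \<Longrightarrow> z < a_zero \<Longrightarrow> f z \<le> M"
    using f_bounded_above by blast
  define b where
    "b n = sqrt (exp ((2 * M + \<bar>c\<bar>) * \<bar>\<alpha>s n - \<alpha>\<bar>) - 1) / (a_zero - max (\<alpha>s n) \<alpha>)" for n
  have "b \<longlonglongrightarrow> sqrt (exp ((2 * M + \<bar>c\<bar>) * \<bar>\<alpha> - \<alpha>\<bar>) - 1) / (a_zero - max \<alpha> \<alpha>)"
    unfolding b_def using \<alpha> by (intro tendsto_intros lim) auto
  then have "b \<longlonglongrightarrow> 0"
    by simp
  moreover have "\<forall>n. norm (cs n - c) \<le> b n"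
  proof
    fix n
    have "a_zero - max (\<alpha>s n) \<alpha> > 0"
      using \<alpha>s[of n] \<alpha> by auto
    then show "norm (cs n - c) \<le> b n"
      using speed_difference_bound[OF p q _ _ \<alpha> M, of n] \<alpha>s[of n] by (simp add: b_def field_simps)
  qed
  ultimately have "(\<lambda>n. cs n - c) \<longlonglongrightarrow> 0"
    by (intro Lim_null_comparison[of "\<lambda>n. cs n - c" b]) auto
  then show ?thesis
    by (simp add: LIM_zero_iff)
qed

lemma wave_profile_continuous:
  assumes w: "\<And>n. wave f a_minus a_zero a_plus (\<alpha>s n) (cs n) (\<phi>s n) (\<phi>s' n)"
    and w0: "wave f a_minus a_zero a_plus \<alpha> c \<phi> \<phi>'"
    and lim: "\<alpha>s \<longlonglongrightarrow> \<alpha>" "cs \<longlonglongrightarrow> c"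
  shows "uniform_limit UNIV \<phi>s \<phi> sequentially"
proof (rule uniform_limitI)
  fix e :: real assume "e > 0"
  interpret w0: wave f a_minus a_zero a_plus \<alpha> c \<phi> \<phi>' by (rule w0)
  obtain K where K: "K \<ge> 0"
    "\<And>x y. x \<in> {a_minus..a_plus} \<Longrightarrow> y \<in> {a_minus..a_plus} \<Longrightarrow> \<bar>f x - f y\<bar> \<le> K * \<bar>x - y\<bar>"
    using f_lipschitz by blast
  have "eventually (\<lambda>x. a_plus - e / 2 < \<phi> x \<and> x > 0) at_top"
    using order_tendstoD(1)[OF w0.\<phi>_lim, of "a_plus - e / 2"] eventually_gt_at_top[of 0] \<open>e > 0\<close>
    by (intro eventually_conj) auto
  then obtain L where L: "a_plus - e / 2 < \<phi> L" "L > 0"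
    using eventually_happens'[OF trivial_limit_at_top_linorder] by blast
  obtain B where B: "\<And>y. 0 \<le> y \<Longrightarrow> y \<le> L \<Longrightarrow> \<bar>\<phi>' y\<bar> \<le> B"
    using wave_slope_bounded[OF w0] by blast
  define C where "C = \<bar>c\<bar> + 1"
  define r where "r n = ((\<alpha>s n - \<alpha>)\<^sup>2 + (cs n - c)\<^sup>2 * B\<^sup>2 * L) * exp ((2 + K + 2 * C) * L)" for n
  have "r \<longlonglongrightarrow> ((\<alpha> - \<alpha>)\<^sup>2 + (c - c)\<^sup>2 * B\<^sup>2 * L) * exp ((2 + K + 2 * C) * L)"
    unfolding r_def by (intro tendsto_intros lim)
  then have "eventually (\<lambda>n. r n < (e / 2)\<^sup>2) sequentially"
    using \<open>e > 0\<close> by (intro order_tendstoD) auto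
  moreover have "eventually (\<lambda>n. \<bar>cs n\<bar> < C) sequentially"
    using order_tendstoD(2)[OF tendsto_rabs[OF lim(2)], of C] by (simp add: C_def)
  ultimately show "eventually (\<lambda>n. \<forall>x\<in>UNIV. dist (\<phi>s n x) (\<phi> x) < e) sequentially"
  proof eventually_elim
    case (elim n)
    interpret wn: wave f a_minus a_zero a_plus "\<alpha>s n" "cs n" "\<phi>s n" "\<phi>s' n" by (rule w)
    have near: "\<bar>\<phi>s n x - \<phi> x\<bar> < e / 2" if x: "0 \<le> x" "x \<le> L" for x
    proof -
      have "(\<phi>s n x - \<phi> x)\<^sup>2 \<le> (\<phi>s n x - \<phi> x)\<^sup>2 + (\<phi>s' n x - \<phi>' x)\<^sup>2"
        by simp
      also have "\<dots> \<le> ((\<alpha>s n - \<alpha>)\<^sup>2 + (cs n - c)\<^sup>2 * B\<^sup>2 * x) * exp ((2 + K + 2 * C) * x)"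
        using wave_distance[OF w w0 K, of x B n C] B x elim by force
      also have "\<dots> \<le> r n"
        unfolding r_def using x K(1)
        by (intro mult_mono add_mono mult_left_mono iffD2[OF exp_le_cancel_iff]) (auto simp: C_def)
      finally have "\<bar>\<phi>s n x - \<phi> x\<bar>\<^sup>2 < (e / 2)\<^sup>2"
        using elim by simp
      then show ?thesis
        by (rule power2_less_imp_less) (use \<open>e > 0\<close> in simp)
    qed
    show ?case
    proof
      fix x :: real
      consider "x \<le> 0" | "0 \<le> x" "x \<le> L" | "L < x"
        by linarith
      then show "dist (\<phi>s n x) (\<phi> x) < e"
      proof cases
        case 1
        then show ?thesis
          using near[of 0] L \<open>e > 0\<close> wn.left[of x] wn.left[of 0] w0.left[of x] w0.left[of 0]
          by (simp add: dist_real_def)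
      next
        case 2
        then show ?thesis
          using near[of x] \<open>e > 0\<close> by (simp add: dist_real_def)
      next
        case 3
        then show ?thesis
          using near[of L] L wn.\<phi>_mono[of L x] w0.\<phi>_mono[of L x] wn.\<phi>_le[of x] w0.\<phi>_le[of x]
          unfolding dist_real_def by linarith
      qed
    qed
  qed
qed

end

theorem proposition1p3:
  fixes f :: "real \<Rightarrow> real" and a_minus a_zero a_plus :: real
  assumes "f C1_differentiable_on UNIV"
    and "a_minus < a_zero" and "a_zero < a_plus"
    and "f a_minus = 0" and "f a_zero = 0" and "f a_plus = 0"
    and "deriv f a_minus > 0" and "deriv f a_plus > 0"
    and "\<forall>z. a_minus < z \<and> z < a_zero \<longrightarrow> f z > 0"
    and "\<forall>z. a_zero < z \<and> z < a_plus \<longrightarrow> f z < 0"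
  shows "(\<forall>\<alpha>\<in>wave_parameters f a_minus a_zero a_plus.
            (\<forall>c1 \<phi>1 c2 \<phi>2.
               degenerate_wave f a_plus \<alpha> c1 \<phi>1 \<and> degenerate_wave f a_plus \<alpha> c2 \<phi>2
                 \<longrightarrow> c1 = c2) \<and>
            (\<forall>c1 \<phi>1 c2 \<phi>2.
               degenerate_wave f a_plus \<alpha> c1 \<phi>1 \<and> degenerate_wave f a_plus \<alpha> c2 \<phi>2
                 \<longrightarrow> (\<exists>h. \<forall>\<xi>. \<phi>2 \<xi> = \<phi>1 (\<xi> + h))))
       \<and> (\<forall>\<alpha>\<in>wave_parameters f a_minus a_zero a_plus.
          \<forall>\<beta>\<in>wave_parameters f a_minus a_zero a_plus.
          \<forall>c \<phi> d \<psi>.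
            \<alpha> < \<beta> \<and> degenerate_wave f a_plus \<alpha> c \<phi> \<and> degenerate_wave f a_plus \<beta> d \<psi>
              \<longrightarrow> d < c)
       \<and> (\<forall>\<alpha>\<in>wave_parameters f a_minus a_zero a_plus.
          \<forall>\<alpha>s :: nat \<Rightarrow> real. \<forall>c \<phi> cs \<phi>s.
            (\<forall>n. \<alpha>s n \<in> wave_parameters f a_minus a_zero a_plus) \<and>
            \<alpha>s \<longlonglongrightarrow> \<alpha> \<and>
            degenerate_wave f a_plus \<alpha> c \<phi> \<and> normalized_profile \<alpha> \<phi> \<and>
            (\<forall>n. degenerate_wave f a_plus (\<alpha>s n) (cs n) (\<phi>s n) \<and>
                 normalized_profile (\<alpha>s n) (\<phi>s n))
              \<longrightarrow> cs \<longlonglongrightarrow> c \<and> uniform_limit UNIV \<phi>s \<phi> sequentially)"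
proof -
  interpret bistable f a_minus a_zero a_plus
    by unfold_locales (use assms in auto)
  have range: "a_minus < \<alpha>" "\<alpha> < a_zero" if "\<alpha> \<in> wave_parameters f a_minus a_zero a_plus" for \<alpha>
    using that by (auto simp: wave_parameters_def)
  have speed: "c1 = c2"
    if "\<alpha> \<in> wave_parameters f a_minus a_zero a_plus"
      "degenerate_wave f a_plus \<alpha> c1 \<phi>1" "degenerate_wave f a_plus \<alpha> c2 \<phi>2" for \<alpha> c1 c2 \<phi>1 \<phi>2
    using degenerate_wave_orbit[OF that(2) range[OF that(1)]]
      degenerate_wave_orbit[OF that(3) range[OF that(1)]] orbit_speed_unique range[OF that(1)]
    by metis
  have profile: "\<exists>h. \<forall>\<xi>. \<phi>2 \<xi> = \<phi>1 (\<xi> + h)"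
    if \<alpha>: "\<alpha> \<in> wave_parameters f a_minus a_zero a_plus"
      and w: "degenerate_wave f a_plus \<alpha> c1 \<phi>1" "degenerate_wave f a_plus \<alpha> c2 \<phi>2" for \<alpha> c1 c2 \<phi>1 \<phi>2
  proof -
    obtain s t where
      s: "wave f a_minus a_zero a_plus \<alpha> c1 (\<lambda>x. \<phi>1 (x + s)) (\<lambda>x. deriv \<phi>1 (x + s))" and
      t: "wave f a_minus a_zero a_plus \<alpha> c2 (\<lambda>x. \<phi>2 (x + t)) (\<lambda>x. deriv \<phi>2 (x + t))"
      using degenerate_wave_shift[OF w(1) range[OF \<alpha>]] degenerate_wave_shift[OF w(2) range[OF \<alpha>]]
      by metis
    have "\<phi>1 (x + s) = \<phi>2 (x + t)" for x
      by (rule wave_profile_unique[OF s]) (use t speed[OF \<alpha> w] in simp)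
    from this[of "\<xi> - t" for \<xi>] have "\<phi>2 \<xi> = \<phi>1 (\<xi> + (s - t))" for \<xi>
      by (simp add: algebra_simps)
    then show ?thesis
      by blast
  qed
  have less: "d < c"
    if "\<alpha> \<in> wave_parameters f a_minus a_zero a_plus" "\<beta> \<in> wave_parameters f a_minus a_zero a_plus"
      "\<alpha> < \<beta>" "degenerate_wave f a_plus \<alpha> c \<phi>" "degenerate_wave f a_plus \<beta> d \<psi>" for \<alpha> \<beta> c d \<phi> \<psi>
    using degenerate_wave_orbit[OF that(4) range[OF that(1)]]
      degenerate_wave_orbit[OF that(5) range[OF that(2)]] orbit_speed_less that(3) range[OF that(2)]
    by metis
  have cont: "cs \<longlonglongrightarrow> c \<and> uniform_limit UNIV \<phi>s \<phi> sequentially"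
    if \<alpha>: "\<alpha> \<in> wave_parameters f a_minus a_zero a_plus"
      and \<alpha>s: "\<And>n. \<alpha>s n \<in> wave_parameters f a_minus a_zero a_plus" "\<alpha>s \<longlonglongrightarrow> \<alpha>"
      and w: "degenerate_wave f a_plus \<alpha> c \<phi>" "normalized_profile \<alpha> \<phi>"
      and ws: "\<And>n. degenerate_wave f a_plus (\<alpha>s n) (cs n) (\<phi>s n)"
        "\<And>n. normalized_profile (\<alpha>s n) (\<phi>s n)"
    for \<alpha> c \<phi> cs \<phi>s and \<alpha>s :: "nat \<Rightarrow> real"
  proof -
    have "\<exists>p. orbit (\<alpha>s n) (cs n) p" for n
      using degenerate_wave_orbit[OF ws(1) range[OF \<alpha>s(1)]] by metis
    then obtain p where p: "\<And>n. orbit (\<alpha>s n) (cs n) (p n)"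
      by metis
    obtain q where q: "orbit \<alpha> c q"
      using degenerate_wave_orbit[OF w(1) range[OF \<alpha>]] by blast
    have cs: "cs \<longlonglongrightarrow> c"
      by (rule speed_continuous[OF p q _ range[OF \<alpha>] \<alpha>s(2)]) (use range[OF \<alpha>s(1)] in blast)
    have "uniform_limit UNIV \<phi>s \<phi> sequentially"
      by (rule wave_profile_continuous[OF wave_of_normalized[OF ws range[OF \<alpha>s(1)]]
            wave_of_normalized[OF w range[OF \<alpha>]] \<alpha>s(2) cs])
    with cs show ?thesis
      by blast
  qed
  show ?thesis
    apply (intro conjI ballI allI impI; elim conjE)
    subgoal by (rule speed)
    subgoal by (rule profile)
    subgoal by (rule less)
    subgoal for \<alpha> \<alpha>s c \<phi> cs \<phi>s using cont[of \<alpha> \<alpha>s c \<phi> cs \<phi>s] by simp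
    subgoal for \<alpha> \<alpha>s c \<phi> cs \<phi>s using cont[of \<alpha> \<alpha>s c \<phi> cs \<phi>s] by simp
    done
qed

end
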